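(* For $n\ge 2$ the algebra $\mathbf{D}(S_n)$ is generated by $D_{ij}$, $1\le i<j\le n$, subject to the following (defining) relations: - $D_{ij}^2=D_{ij}$ for all $1\le i<j\le n$; - $D_{ij}D_{k\ell}=D_{k\ell}D_{ij}$ whenever $\{i,j\}\cap\{k,\ell\}=\emptyset$; - $D_{ij}D_{jk}=D_{ik}D_{ij}+D_{jk}D_{ik}-D_{ik}$ and $D_{jk}D_{ij}=D_{ij}D_{ik}+D_{ik}D_{jk}-D_{ik}$ for $1\le i<j<k\le n$.
   Context: For $n\ge 2$, $\mathbf{H}(S_n)$ denotes the (unital associative) $\mathbb{Z}$-algebra generated by $s_i$ and $D_i$, $i=1,\ldots,n-1$, subject to the relations: (1) $s_i^2=1$, $s_iD_i+D_is_i=s_i-1$, $D_i^2=D_i$ for $i=1,\ldots,n-1$; (2) $s_js_i=s_is_j$, $D_js_i=s_iD_j$, $D_jD_i=D_iD_j$ if $|i-j|>1$; (3) $s_js_is_j=s_is_js_i$, $D_is_js_i=s_js_iD_j$, $D_js_iD_j=s_iD_jD_i+D_iD_js_i+s_iD_js_i$ if $|i-j|=1$. The group ring $\mathbb{Z}S_n$ maps to $\mathbf{H}(S_n)$ by sending the simple transposition $(i,i+1)$ to $s_i$. The elements $D_{ij}\in\mathbf{H}(S_n)$, $1\le i<j\le n$, are defined by $D_{i,i+1}=D_i$ and $wD_{ij}w^{-1}=D_{w(i),w(j)}$ for any permutation $w\in S_n$ such that $w(i)<w(j)$ (these elements are well-defined). $\mathbf{D}(S_n)$ is the $\mathbb{Z}$-subalgebra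 of $\mathbf{H}(S_n)$ generated by all $D_{ij}$, $1\le i<j\le n$. *)

theory Defs
  imports
    "HOL-Library.Poly_Mapping"
    "HOL-Algebra.QuotRing"
    "HOL-Algebra.Generated_Rings"
    "HOL-Algebra.Sym_Groups"
begin

section \<open>Rings given by generators and relations\<close>

text \<open>The free monoid on a type of letters, written additively because \<^type>\<open>poly_mapping\<close>
  builds its convolution product from an additive monoid of exponents.  Hence
  \<open>'g word \<Rightarrow>\<^sub>0 int\<close> is the monoid ring of the free monoid over the integers, that is, the free
  unital associative \<open>\<int>\<close>-algebra on \<open>'g\<close>.  A unital associative \<open>\<int>\<close>-algebra is the same
  thing as a unital ring; a \<open>\<int>\<close>-subalgebra is the same thing as a unital subring.\<close>

datatype 'g word = Word (letters: "'g list")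

instantiation word :: (type) monoid_add
begin

definition zero_word :: "'a word" where
  "zero_word = Word []"

definition plus_word :: "'a word \<Rightarrow> 'a word \<Rightarrow> 'a word" where
  "plus_word v w = Word (letters v @ letters w)"

instance
  by standard (simp_all add: zero_word_def plus_word_def word.expand)

end

type_synonym 'g free_alg = "'g word \<Rightarrow>\<^sub>0 int"

definition gen :: "'g \<Rightarrow> 'g free_alg" where
  "gen x = Poly_Mapping.single (Word [x]) 1"

text \<open>The free algebra on a set \<open>X\<close> of letters, as a ring object.\<close>

definition free_ring :: "'g set \<Rightarrow> 'g free_alg ring" where
  "free_ring X = \<lparr>carrier = {p. \<forall>w\<in>Poly_Mapping.keys p. set (letters w) \<subseteq> X},
     monoid.mult = (*), one = 1, zero = 0, add = (+)\<rparr>"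

text \<open>A relation \<open>l = r\<close> is represented by the element \<open>l - r\<close>; \<^const>\<open>genideal\<close> is the
  two-sided ideal generated by these elements.\<close>

definition presented_ring :: "'g set \<Rightarrow> 'g free_alg set \<Rightarrow> 'g free_alg set ring" where
  "presented_ring X R = free_ring X Quot (Idl\<^bsub>free_ring X\<^esub> R)"

definition presented_gen :: "'g set \<Rightarrow> 'g free_alg set \<Rightarrow> 'g \<Rightarrow> 'g free_alg set" where
  "presented_gen X R x = (Idl\<^bsub>free_ring X\<^esub> R) +>\<^bsub>free_ring X\<^esub> gen x"

lemma free_ring_closed:
  "gen x \<in> carrier (free_ring X) \<longleftrightarrow> x \<in> X"
  "1 \<in> carrier (free_ring X)"
  "0 \<in> carrier (free_ring X)"
  "p \<in> carrier (free_ring X) \<Longrightarrow> - p \<in> carrier (free_ring X)"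
  "p \<in> carrier (free_ring X) \<Longrightarrow> q \<in> carrier (free_ring X) \<Longrightarrow> p + q \<in> carrier (free_ring X)"
  "p \<in> carrier (free_ring X) \<Longrightarrow> q \<in> carrier (free_ring X) \<Longrightarrow> p - q \<in> carrier (free_ring X)"
  "p \<in> carrier (free_ring X) \<Longrightarrow> q \<in> carrier (free_ring X) \<Longrightarrow> p * q \<in> carrier (free_ring X)"
  using keys_add[of p q] keys_diff[of p q] keys_mult[of p q]
  by (fastforce simp: free_ring_def gen_def zero_word_def plus_word_def)+

lemma ring_free_ring: "ring (free_ring X)"
proof (rule ringI)
  show "abelian_group (free_ring X)"
  proof (rule abelian_groupI)
    fix p assume "p \<in> carrier (free_ring X)"
    then show "\<exists>q\<in>carrier (free_ring X). q \<oplus>\<^bsub>free_ring X\<^esub> p = \<zero>\<^bsub>free_ring X\<^esub>"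
      using free_ring_closed(4)[of p X] by (intro bexI[of _ "- p"]) (auto simp: free_ring_def)
  qed (use free_ring_closed in \<open>simp_all add: free_ring_def algebra_simps\<close>)
  show "Group.monoid (free_ring X)"
    by (rule monoidI) (use free_ring_closed in \<open>simp_all add: free_ring_def algebra_simps\<close>)
qed (simp_all add: free_ring_def algebra_simps)

lemma ring_presented_ring: "R \<subseteq> carrier (free_ring X) \<Longrightarrow> ring (presented_ring X R)"
  unfolding presented_ring_def
  by (intro ideal.quotient_is_ring ring.genideal_ideal ring_free_ring)


section \<open>The algebra \<open>H(S\<^sub>n)\<close>\<close>

datatype hgen = S nat | D nat

definition H_gens :: "nat \<Rightarrow> hgen set" where
  "H_gens n = S ` {1..<n} \<union> D ` {1..<n}"

definition H_relators :: "nat \<Rightarrow> hgen free_alg set" where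
  "H_relators n =
     (let s = (\<lambda>i. gen (S i)); d = (\<lambda>i. gen (D i)) in
      (\<Union>i\<in>{1..<n}.
        {s i ^ 2 - 1,
         (s i * d i + d i * s i) - (s i - 1),
         d i ^ 2 - d i}) \<union>
      (\<Union>(i, j)\<in>{(i, j). i \<in> {1..<n} \<and> j \<in> {1..<n} \<and> \<bar>int i - int j\<bar> > 1}.
        {s j * s i - s i * s j,
         d j * s i - s i * d j,
         d j * d i - d i * d j}) \<union>
      (\<Union>(i, j)\<in>{(i, j). i \<in> {1..<n} \<and> j \<in> {1..<n} \<and> \<bar>int i - int j\<bar> = 1}.
        {s j * s i * s j - s i * s j * s i,
         d i * s j * s i - s j * s i * d j,
         d j * s i * d j - (s i * d j * d i + d i * d j * s i + s i * d j * s i)}))"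

definition H_alg :: "nat \<Rightarrow> hgen free_alg set ring" where
  "H_alg n = presented_ring (H_gens n) (H_relators n)"

definition H_s :: "nat \<Rightarrow> nat \<Rightarrow> hgen free_alg set" where
  "H_s n i = presented_gen (H_gens n) (H_relators n) (S i)"

definition H_D :: "nat \<Rightarrow> nat \<Rightarrow> hgen free_alg set" where
  "H_D n i = presented_gen (H_gens n) (H_relators n) (D i)"

lemma H_relators_closed: "H_relators n \<subseteq> carrier (free_ring (H_gens n))"
  by (auto simp: H_relators_def Let_def power2_eq_square H_gens_def intro!: free_ring_closed
      simp: free_ring_closed(1))

lemma ring_H_alg: "ring (H_alg n)"
  unfolding H_alg_def by (intro ring_presented_ring H_relators_closed)

text \<open>The restriction to \<open>S\<^sub>n\<close> of the homomorphism from the group ring: the group homomorphism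
  from \<open>S\<^sub>n\<close> into the units of \<open>H(S\<^sub>n)\<close> sending the transposition \<open>(i, i+1)\<close> to \<open>s\<^sub>i\<close>.  The
  product of \<^const>\<open>sym_group\<close> is composition of functions.  Extensionality is imposed only to
  make the function unique.\<close>

definition perm_img :: "nat \<Rightarrow> (nat \<Rightarrow> nat) \<Rightarrow> hgen free_alg set" where
  "perm_img n = (THE \<phi>.
     \<phi> \<in> hom (sym_group n) (units_of (H_alg n)) \<and>
     \<phi> \<in> extensional (carrier (sym_group n)) \<and>
     (\<forall>i\<in>{1..<n}. \<phi> (Transposition.transpose i (i + 1)) = H_s n i))"

definition pairs :: "nat \<Rightarrow> (nat \<times> nat) set" where
  "pairs n = {(i, j). 1 \<le> i \<and> i < j \<and> j \<le> n}"

text \<open>The family of all \<open>D\<^sub>i\<^sub>j\<close>, indexed by \<open>pairs n\<close>.\<close>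

definition D_family :: "nat \<Rightarrow> nat \<times> nat \<Rightarrow> hgen free_alg set" where
  "D_family n = (THE E.
     E \<in> pairs n \<rightarrow>\<^sub>E carrier (H_alg n) \<and>
     (\<forall>i\<in>{1..<n}. E (i, i + 1) = H_D n i) \<and>
     (\<forall>w\<in>carrier (sym_group n). \<forall>(i, j)\<in>pairs n. w i < w j \<longrightarrow>
        perm_img n w \<otimes>\<^bsub>H_alg n\<^esub> E (i, j) \<otimes>\<^bsub>H_alg n\<^esub> inv\<^bsub>H_alg n\<^esub> perm_img n w = E (w i, w j)))"

definition D_alg :: "nat \<Rightarrow> hgen free_alg set ring" where
  "D_alg n = (H_alg n)\<lparr>carrier := generate_ring (H_alg n) (D_family n ` pairs n)\<rparr>"


section \<open>The presentation of \<open>D(S\<^sub>n)\<close>\<close>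

definition D_relators :: "nat \<Rightarrow> (nat \<times> nat) free_alg set" where
  "D_relators n =
     (let x = (\<lambda>i j. gen (i, j)) in
      {x i j ^ 2 - x i j | i j. (i, j) \<in> pairs n} \<union>
      {x i j * x k l - x k l * x i j | i j k l.
         (i, j) \<in> pairs n \<and> (k, l) \<in> pairs n \<and> {i, j} \<inter> {k, l} = {}} \<union>
      {x i j * x j k - (x i k * x i j + x j k * x i k - x i k) | i j k.
         1 \<le> i \<and> i < j \<and> j < k \<and> k \<le> n} \<union>
      {x j k * x i j - (x i j * x i k + x i k * x j k - x i k) | i j k.
         1 \<le> i \<and> i < j \<and> j < k \<and> k \<le> n})"

lemma D_relators_closed: "D_relators n \<subseteq> carrier (free_ring (pairs n))"
  by (auto simp: D_relators_def Let_def power2_eq_square intro!: free_ring_closed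
      simp: free_ring_closed(1)) (auto simp: pairs_def)

end

theory Submission
  imports Defs
begin

text \<open>Sending \<open>D\<^sub>i\<^sub>j\<close> to an explicit word in the generators of \<open>H(S\<^sub>n)\<close> respects the relations:
  conjugation by permutations reduces each of them to \<open>D\<^sub>1\<close>, \<open>D\<^sub>2\<close>, \<open>D\<^sub>3\<close>.  For injectivity, \<open>H(S\<^sub>n)\<close>
  is made to act on the abstractly presented algebra, as if this were the module induced from the
  trivial representation of \<open>S\<^sub>n\<close>: \<open>D\<^sub>i\<close> acts by left multiplication, while \<open>s\<^sub>i\<close> fixes \<open>1\<close>, satisfies
  \<open>s\<^sub>i D\<^sub>i = (1 - D\<^sub>i) s\<^sub>i - 1\<close>, and moves past the other \<open>D\<^sub>j\<^sub>k\<close> by permuting their indices.  Every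
  \<open>D\<^sub>j\<^sub>k\<close> then acts by left multiplication, so an element whose image vanishes in \<open>H(S\<^sub>n)\<close> is
  recovered as zero from its action on \<open>1\<close>.  The operators live on the free algebra, where all
  these identities except the relators among the \<open>D\<^sub>j\<^sub>k\<close> already hold exactly.\<close>

section \<open>Free algebras and their ideals\<close>

lemma one_free_alg: "1 = frag_of (Word [])"
  by (metis single_one zero_word_def)

lemma gen_mult_word: "gen x * frag_of (Word l) = frag_of (Word (x # l))"
  by (simp add: gen_def mult_single plus_word_def)

lemma free_ring_simps:
  "x \<otimes>\<^bsub>free_ring X\<^esub> y = x * y" "x \<oplus>\<^bsub>free_ring X\<^esub> y = x + y"
  "\<one>\<^bsub>free_ring X\<^esub> = 1" "\<zero>\<^bsub>free_ring X\<^esub> = 0"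
  by (simp_all add: free_ring_def)

lemma free_ring_a_inv:
  assumes "p \<in> carrier (free_ring X)"
  shows "\<ominus>\<^bsub>free_ring X\<^esub> p = - p"
proof -
  interpret ring "free_ring X" by (rule ring_free_ring)
  show ?thesis
    by (rule minus_equality) (use assms free_ring_closed(4)[OF assms] in \<open>simp_all add: free_ring_simps\<close>)
qed

lemma carrier_free_ring_UNIV: "p \<in> carrier (free_ring UNIV)"
  by (simp add: free_ring_def)

text \<open>Letters are peeled off on the left, which suits operators whose effect is prescribed on
  the first letter of a word. Differences alone are enough: zero arises as \<open>1 - 1\<close>, and
  sums and negatives from it.\<close>

lemma free_ring_induct [consumes 1, case_names one gen_mult diff]:
  assumes p: "p \<in> carrier (free_ring X)"
    and one: "P 1"
    and gen_mult: "\<And>x q. x \<in> X \<Longrightarrow> q \<in> carrier (free_ring X) \<Longrightarrow> P q \<Longrightarrow> P (gen x * q)"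
    and diff: "\<And>p q. p \<in> carrier (free_ring X) \<Longrightarrow> q \<in> carrier (free_ring X) \<Longrightarrow>
      P p \<Longrightarrow> P q \<Longrightarrow> P (p - q)"
  shows "P p"
proof -
  have words: "frag_of (Word l) \<in> carrier (free_ring X) \<and> P (frag_of (Word l))"
    if "set l \<subseteq> X" for l
    using that
  proof (induction l)
    case Nil
    then show ?case
      using one free_ring_closed(2) by (metis one_free_alg)
  next
    case (Cons x l)
    then show ?case
      using gen_mult[of x "frag_of (Word l)"] free_ring_closed(1)[of x X]
        free_ring_closed(7)[of "gen x" X "frag_of (Word l)"]
      by (simp add: gen_mult_word)
  qed
  have "Poly_Mapping.keys p \<subseteq> {w. set (letters w) \<subseteq> X}"
    using p by (auto simp: free_ring_def)
  then have "p \<in> carrier (free_ring X) \<and> P p"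
  proof (induction rule: frag_induction)
    case zero
    then show ?case
      using diff[of 1 1] one by (simp add: free_ring_closed)
  next
    case (one w)
    then show ?case
      using words[of "letters w"] by simp
  next
    case (diff p q)
    then show ?case
      by (simp add: assms(4) free_ring_closed)
  qed
  then show ?thesis ..
qed

section \<open>Additive extension from words: substitutions and operator actions\<close>

definition word_extend :: "('g list \<Rightarrow> 'h free_alg) \<Rightarrow> 'g free_alg \<Rightarrow> 'h free_alg" where
  "word_extend F = frag_extend (\<lambda>w. F (letters w))"

lemma word_extend_simps [simp]:
  "word_extend F 0 = 0"
  "word_extend F 1 = F []"
  "word_extend F (p + q) = word_extend F p + word_extend F q"
  "word_extend F (p - q) = word_extend F p - word_extend F q"
  by (simp_all add: word_extend_def one_free_alg frag_extend_add frag_extend_diff)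

lemma word_extend_word: "word_extend F (frag_of (Word l)) = F l"
  by (simp add: word_extend_def)

text \<open>Both sides are additive in \<open>p\<close>, so agreement on basis words suffices. The
  rules for a leading letter under \<open>subst_alg\<close>, \<open>act\<close> and
  \<open>s_op\<close> are all instances; \<open>T\<close> may itself involve
  \<open>word_extend F\<close>.\<close>

lemma word_extend_gen_mult:
  assumes "\<And>l. F (x # l) = T (frag_of (Word l))"
    and "\<And>p q. T (p - q) = T p - T q"
  shows "word_extend F (gen x * p) = T p"
proof -
  have "Poly_Mapping.keys p \<subseteq> UNIV"
    by simp
  then show ?thesis
  proof (induction rule: frag_induction)
    case zero
    then show ?case
      using assms(2)[of 0 0] by simp
  next
    case (one w)
    then show ?case
      by (cases w) (simp add: gen_mult_word word_extend_word assms(1))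
  next
    case (diff p q)
    then show ?case
      by (simp add: right_diff_distrib assms(2))
  qed
qed

definition subst_alg :: "('g \<Rightarrow> 'h free_alg) \<Rightarrow> 'g free_alg \<Rightarrow> 'h free_alg" where
  "subst_alg d = word_extend (\<lambda>l. prod_list (map d l))"

lemma subst_alg_linear [simp]:
  "subst_alg d 0 = 0"
  "subst_alg d 1 = 1"
  "subst_alg d (p + q) = subst_alg d p + subst_alg d q"
  "subst_alg d (p - q) = subst_alg d p - subst_alg d q"
  by (simp_all add: subst_alg_def)

lemma subst_alg_gen_mult [simp]: "subst_alg d (gen x * p) = d x * subst_alg d p"
  unfolding subst_alg_def
  by (rule word_extend_gen_mult) (simp_all add: word_extend_word right_diff_distrib)

lemma subst_alg_gen [simp]: "subst_alg d (gen x) = d x"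
  using subst_alg_gen_mult[of d x 1] by simp

lemma subst_alg_mult: "subst_alg d (p * q) = subst_alg d p * subst_alg d q"
  using carrier_free_ring_UNIV[of p]
  by (induction rule: free_ring_induct) (simp_all add: mult.assoc left_diff_distrib)

lemma subst_alg_closed:
  assumes "p \<in> carrier (free_ring X)" "\<And>x. x \<in> X \<Longrightarrow> d x \<in> carrier (free_ring Y)"
  shows "subst_alg d p \<in> carrier (free_ring Y)"
  using assms(1) by (induction rule: free_ring_induct) (simp_all add: free_ring_closed assms(2))

lemma subst_alg_ring_hom:
  assumes "\<And>x. x \<in> X \<Longrightarrow> d x \<in> carrier (free_ring Y)"
  shows "subst_alg d \<in> ring_hom (free_ring X) (free_ring Y)"
  by (rule ring_hom_memI) (simp_all add: subst_alg_closed[OF _ assms] subst_alg_mult free_ring_simps)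

text \<open>The left module over a free algebra given by one operator per letter. With
  \<open>foldr\<close> the rightmost letter acts first, so products become compositions as soon as
  the operators are additive.\<close>

definition act :: "('h \<Rightarrow> 'g free_alg \<Rightarrow> 'g free_alg) \<Rightarrow> 'h free_alg \<Rightarrow> 'g free_alg \<Rightarrow> 'g free_alg"
  where "act \<rho> h y = word_extend (\<lambda>l. foldr \<rho> l y) h"

lemma act_linear [simp]:
  "act \<rho> 0 y = 0"
  "act \<rho> 1 y = y"
  "act \<rho> (p + q) y = act \<rho> p y + act \<rho> q y"
  "act \<rho> (p - q) y = act \<rho> p y - act \<rho> q y"
  by (simp_all add: act_def)

context
  fixes \<rho> :: "'h \<Rightarrow> 'g free_alg \<Rightarrow> 'g free_alg"
  assumes additive: "\<And>x p q. \<rho> x (p - q) = \<rho> x p - \<rho> x q"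
begin

lemma act_gen_mult: "act \<rho> (gen x * p) y = \<rho> x (act \<rho> p y)"
  unfolding act_def by (rule word_extend_gen_mult) (simp_all add: word_extend_word additive)

lemma act_gen: "act \<rho> (gen x) y = \<rho> x y"
  using act_gen_mult[of x 1] by simp

lemma act_mult: "act \<rho> (p * q) y = act \<rho> p (act \<rho> q y)"
  using carrier_free_ring_UNIV[of p]
  by (induction rule: free_ring_induct) (simp_all add: mult.assoc left_diff_distrib act_gen_mult)

end

section \<open>Ideals of free algebras and their quotients\<close>

lemma ideal_free_ringI:
  assumes "I \<subseteq> carrier (free_ring X)" "0 \<in> I"
    and diff: "\<And>p q. p \<in> I \<Longrightarrow> q \<in> I \<Longrightarrow> p - q \<in> I"
    and "\<And>p x. p \<in> I \<Longrightarrow> x \<in> carrier (free_ring X) \<Longrightarrow> x * p \<in> I"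
    and "\<And>p x. p \<in> I \<Longrightarrow> x \<in> carrier (free_ring X) \<Longrightarrow> p * x \<in> I"
  shows "ideal I (free_ring X)"
proof (rule idealI)
  interpret ring "free_ring X" by (rule ring_free_ring)
  have neg: "- p \<in> I" if "p \<in> I" for p
    using diff[OF assms(2) that] by simp
  have "p + q \<in> I" if "p \<in> I" "q \<in> I" for p q
    using diff[OF that(1) neg[OF that(2)]] by simp
  then show "subgroup I (add_monoid (free_ring X))"
    using assms(1,2) neg free_ring_a_inv[of _ X]
    by (intro add.subgroupI) (auto simp: free_ring_simps a_inv_def[symmetric])
qed (use assms in \<open>simp_all add: ring_free_ring free_ring_simps\<close>)

lemma ideal_free_ringD:
  assumes "ideal I (free_ring X)"
  shows "I \<subseteq> carrier (free_ring X)" "0 \<in> I"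
    and "\<And>p q. p \<in> I \<Longrightarrow> q \<in> I \<Longrightarrow> p + q \<in> I"
    and "\<And>p. p \<in> I \<Longrightarrow> - p \<in> I"
    and "\<And>p q. p \<in> I \<Longrightarrow> q \<in> I \<Longrightarrow> p - q \<in> I"
    and "\<And>p x. p \<in> I \<Longrightarrow> x \<in> carrier (free_ring X) \<Longrightarrow> x * p \<in> I"
    and "\<And>p x. p \<in> I \<Longrightarrow> x \<in> carrier (free_ring X) \<Longrightarrow> p * x \<in> I"
proof -
  interpret ideal I "free_ring X" by (rule assms)
  show *: "I \<subseteq> carrier (free_ring X)"
    by (rule a_subset)
  show "0 \<in> I"
    using additive_subgroup.zero_closed[OF is_additive_subgroup] by (simp add: free_ring_simps)
  show add: "p + q \<in> I" if "p \<in> I" "q \<in> I" for p q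
    using additive_subgroup.a_closed[OF is_additive_subgroup that] by (simp add: free_ring_simps)
  show neg: "- p \<in> I" if "p \<in> I" for p
    using additive_subgroup.a_inv_closed[OF is_additive_subgroup that] free_ring_a_inv[of p X] * that by auto
  show "p - q \<in> I" if "p \<in> I" "q \<in> I" for p q
    using add[OF that(1) neg[OF that(2)]] by simp
  show "x * p \<in> I" if "p \<in> I" "x \<in> carrier (free_ring X)" for p x
    using I_l_closed[OF that] by (simp add: free_ring_simps)
  show "p * x \<in> I" if "p \<in> I" "x \<in> carrier (free_ring X)" for p x
    using I_r_closed[OF that] by (simp add: free_ring_simps)
qed

lemma Idl_free_ring_subset:
  assumes "R \<subseteq> I" "ideal I (free_ring X)"
  shows "Idl\<^bsub>free_ring X\<^esub> R \<subseteq> I"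
  using ring.genideal_minimal[OF ring_free_ring assms(2,1)] .

lemma presented_proj_hom:
  assumes "R \<subseteq> carrier (free_ring X)"
  shows "ring_hom_ring (free_ring X) (presented_ring X R) ((+>\<^bsub>free_ring X\<^esub>) (Idl\<^bsub>free_ring X\<^esub> R))"
  unfolding presented_ring_def
  by (intro ideal.rcos_ring_hom_ring ring.genideal_ideal ring_free_ring assms)

lemma presented_proj_eq_iff:
  assumes "R \<subseteq> carrier (free_ring X)" "p \<in> carrier (free_ring X)" "q \<in> carrier (free_ring X)"
  shows "(Idl\<^bsub>free_ring X\<^esub> R) +>\<^bsub>free_ring X\<^esub> p = (Idl\<^bsub>free_ring X\<^esub> R) +>\<^bsub>free_ring X\<^esub> q \<longleftrightarrow>
    p - q \<in> Idl\<^bsub>free_ring X\<^esub> R"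
proof -
  interpret ring "free_ring X" by (rule ring_free_ring)
  have "ideal (Idl\<^bsub>free_ring X\<^esub> R) (free_ring X)"
    by (rule genideal_ideal[OF assms(1)])
  then show ?thesis
    using quotient_eq_iff_same_a_r_cos[of "Idl\<^bsub>free_ring X\<^esub> R" p q] assms(2,3)
      free_ring_a_inv[OF assms(3)]
    by (simp add: a_minus_def free_ring_simps)
qed

text \<open>The first isomorphism theorem. The image of \<open>h\<close> is the subring generated by
  the images of the letters because letters generate the free algebra; that the kernel is exactly
  the ideal of \<open>R\<close> is what makes the relations defining.\<close>

lemma presented_ring_iso:
  assumes R: "R \<subseteq> carrier (free_ring X)"
    and hom: "ring_hom_ring (free_ring X) A h"
    and ker: "\<And>p. p \<in> carrier (free_ring X) \<Longrightarrow> h p = \<zero>\<^bsub>A\<^esub> \<longleftrightarrow> p \<in> Idl\<^bsub>free_ring X\<^esub> R"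
  shows "\<exists>\<phi> \<in> ring_iso (presented_ring X R) (A\<lparr>carrier := generate_ring A (h ` gen ` X)\<rparr>).
    \<forall>x \<in> X. \<phi> (presented_gen X R x) = h (gen x)"
proof -
  interpret h: ring_hom_ring "free_ring X" A h by (rule hom)
  have Idl: "ideal (Idl\<^bsub>free_ring X\<^esub> R) (free_ring X)"
    by (rule h.R.genideal_ideal[OF R])
  have kernel: "a_kernel (free_ring X) A h = Idl\<^bsub>free_ring X\<^esub> R"
    unfolding a_kernel_def' using ker ideal_free_ringD(1)[OF Idl] by blast
  have gens: "h ` gen ` X \<subseteq> carrier A"
    by (auto simp: free_ring_closed)
  have "h ` carrier (free_ring X) = generate_ring A (h ` gen ` X)" (is "_ = ?G")
  proof
    have sub: "subring ?G A"
      by (rule h.S.generate_ring_is_subring[OF gens])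
    have "h p \<in> ?G" if "p \<in> carrier (free_ring X)" for p
      using that
    proof (induction rule: free_ring_induct)
      case one
      then show ?case
        using h.hom_one generate_ring.one[of A] by (simp add: free_ring_simps)
    next
      case (gen_mult x q)
      then have "h (gen x * q) = h (gen x) \<otimes>\<^bsub>A\<^esub> h q"
        using h.hom_mult[of "gen x" q] by (simp add: free_ring_closed free_ring_simps)
      then show ?case
        using gen_mult by (auto intro: generate_ring.intros)
    next
      case (diff p q)
      then have "h (p - q) = h p \<oplus>\<^bsub>A\<^esub> (\<ominus>\<^bsub>A\<^esub> h q)"
        using h.hom_add[of p "- q"] h.hom_a_inv[of q]
        by (simp add: free_ring_closed free_ring_simps free_ring_a_inv)
      then show ?case
        using diff by (auto intro: generate_ring.intros)
    qed
    then show "h ` carrier (free_ring X) \<subseteq> ?G"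
      by auto
  next
    show "?G \<subseteq> h ` carrier (free_ring X)"
    proof (rule h.S.generate_ring_min_subring1[OF gens])
      show "subring (h ` carrier (free_ring X)) A"
        by (intro h.img_is_subring h.R.carrier_is_subring)
    qed (auto simp: free_ring_closed)
  qed
  \<comment> \<open>The induced map sends a coset to the single value that \<open>h\<close> takes on
    it.\<close>
  moreover have "the_elem (h ` presented_gen X R x) = h (gen x)" if "x \<in> X" for x
    using h.the_elem_simp[of "gen x"] that
    by (simp add: presented_gen_def kernel free_ring_closed)
  ultimately show ?thesis
    using h.FactRing_iso_set_aux unfolding kernel presented_ring_def
    by (intro bexI[of _ "\<lambda>Y. the_elem (h ` Y)"]) auto
qed

section \<open>The action on the presented algebra\<close>

text \<open>Recursion on words leaves no relations to check, since the domain is free. An increasing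
  pair other than \<open>(i, Suc i)\<close> stays increasing under the transposition; the one pair
  that would be reversed follows \<open>s_i D_i + D_i s_i = s_i - 1\<close> instead.\<close>

primrec s_word :: "nat \<Rightarrow> (nat \<times> nat) list \<Rightarrow> (nat \<times> nat) free_alg" where
  "s_word i [] = 1"
| "s_word i (g # l) =
    (if g = (i, Suc i) then (1 - gen g) * s_word i l - frag_of (Word l)
     else gen (map_prod (Transposition.transpose i (Suc i)) (Transposition.transpose i (Suc i)) g) * s_word i l)"

definition s_op :: "nat \<Rightarrow> (nat \<times> nat) free_alg \<Rightarrow> (nat \<times> nat) free_alg" where
  "s_op i = word_extend (s_word i)"

fun H_op :: "hgen \<Rightarrow> (nat \<times> nat) free_alg \<Rightarrow> (nat \<times> nat) free_alg" where
  "H_op (S i) y = s_op i y"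
| "H_op (D i) y = gen (i, Suc i) * y"

lemma s_op_linear [simp]:
  "s_op i 0 = 0"
  "s_op i 1 = 1"
  "s_op i (p + q) = s_op i p + s_op i q"
  "s_op i (p - q) = s_op i p - s_op i q"
  by (simp_all add: s_op_def)

lemma s_op_gen_mult:
  "s_op i (gen (j, k) * y) =
    (if j = i \<and> k = Suc i then s_op i y - gen (j, k) * s_op i y - y
     else gen (Transposition.transpose i (Suc i) j, Transposition.transpose i (Suc i) k) * s_op i y)"
proof (cases "j = i \<and> k = Suc i")
  case True
  have "s_op i (gen (j, k) * y) = (1 - gen (j, k)) * s_op i y - y"
    unfolding s_op_def using True
    by (intro word_extend_gen_mult) (simp_all add: word_extend_word right_diff_distrib)
  then show ?thesis
    using True by (simp add: left_diff_distrib)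
next
  case False
  then show ?thesis
    unfolding s_op_def
    by (auto intro!: word_extend_gen_mult simp: word_extend_word right_diff_distrib)
qed

lemma s_op_gen_mult_neq:
  "(j, k) \<noteq> (i, Suc i) \<Longrightarrow> s_op i (gen (j, k) * y) =
    gen (Transposition.transpose i (Suc i) j, Transposition.transpose i (Suc i) k) * s_op i y"
  by (auto simp: s_op_gen_mult)

lemma H_op_diff: "H_op x (p - q) = H_op x p - H_op x q"
  by (cases x) (simp_all add: right_diff_distrib)

lemmas H_act_simps = act_gen[of H_op, OF H_op_diff] act_mult[of H_op, OF H_op_diff]

section \<open>Coxeter relations for the operators, holding exactly in the free algebra\<close>

lemma transpose_Suc_pairs:
  assumes "(j, k) \<in> pairs n" "(j, k) \<noteq> (i, Suc i)" "i \<in> {1..<n}"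
  shows "(Transposition.transpose i (Suc i) j, Transposition.transpose i (Suc i) k) \<in> pairs n"
  using assms by (auto simp: pairs_def Transposition.transpose_def)

lemma s_op_closed:
  assumes "i \<in> {1..<n}" "y \<in> carrier (free_ring (pairs n))"
  shows "s_op i y \<in> carrier (free_ring (pairs n))"
  using assms(2)
proof (induction rule: free_ring_induct)
  case (gen_mult x q)
  obtain j k where x: "x = (j, k)"
    by (cases x)
  show ?case
    using gen_mult transpose_Suc_pairs[of j k n i] assms(1)
    by (auto simp: x s_op_gen_mult free_ring_closed)
qed (simp_all add: free_ring_closed)

text \<open>On a leading \<open>D_i\<close> the corrections cancel:
  \<open>s_i ((1 - D_i) s_i q - q)\<close> expands to \<open>D_i q\<close> once
  \<open>s_i s_i q = q\<close> is known. Letters from \<open>pairs n\<close> exclude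
  \<open>(Suc i, i)\<close>, which would be swapped into \<open>(i, Suc i)\<close> and not come
  back.\<close>

lemma s_op_involution:
  assumes "i \<in> {1..<n}" "y \<in> carrier (free_ring (pairs n))"
  shows "s_op i (s_op i y) = y"
  using assms(2)
proof (induction rule: free_ring_induct)
  case (gen_mult x q)
  then show ?case
    by (cases x) (auto simp: pairs_def s_op_gen_mult Transposition.transpose_def algebra_simps)
qed simp_all

lemma s_op_commute:
  assumes "i + 1 < j" "y \<in> carrier (free_ring (pairs n))"
  shows "s_op i (s_op j y) = s_op j (s_op i y)"
  using assms(2)
proof (induction rule: free_ring_induct)
  case (gen_mult x q)
  then show ?case
    using assms(1)
    by (cases x) (auto simp: pairs_def s_op_gen_mult Transposition.transpose_def algebra_simps)
qed simp_all

text \<open>Corrections arise only for leading pairs inside \<open>{i, i+1, i+2}\<close>. For the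
  outer pair \<open>(i, i+2)\<close> the leftover terms are \<open>s_i s_i q\<close> on one side and
  \<open>s_(i+1) s_(i+1) q\<close> on the other, both equal to \<open>q\<close> by the
  involution.\<close>

lemma s_op_braid:
  assumes "i \<in> {1..<n}" "Suc i \<in> {1..<n}" "y \<in> carrier (free_ring (pairs n))"
  shows "s_op i (s_op (Suc i) (s_op i y)) = s_op (Suc i) (s_op i (s_op (Suc i) y))"
  using assms(3)
proof (induction rule: free_ring_induct)
  case (gen_mult x q)
  then show ?case
    using s_op_involution[OF assms(1)] s_op_involution[OF assms(2)]
    by (cases x) (auto simp: pairs_def s_op_gen_mult Transposition.transpose_def algebra_simps)
qed simp_all

section \<open>Invariance of the ideal of relators under the operators \<open>s_op\<close>\<close>

lemma pairs_Suc [simp]: "(i, Suc i) \<in> pairs n \<longleftrightarrow> i \<in> {1..<n}"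
  by (auto simp: pairs_def)

lemma D_relators_mems:
  "(i, j) \<in> pairs n \<Longrightarrow> gen (i, j) * gen (i, j) - gen (i, j) \<in> D_relators n"
  "(i, j) \<in> pairs n \<Longrightarrow> (k, l) \<in> pairs n \<Longrightarrow> {i, j} \<inter> {k, l} = {} \<Longrightarrow>
    gen (i, j) * gen (k, l) - gen (k, l) * gen (i, j) \<in> D_relators n"
  "(i, j) \<in> pairs n \<Longrightarrow> (j, k) \<in> pairs n \<Longrightarrow>
    gen (i, j) * gen (j, k) - (gen (i, k) * gen (i, j) + gen (j, k) * gen (i, k) - gen (i, k))
      \<in> D_relators n"
  "(i, j) \<in> pairs n \<Longrightarrow> (j, k) \<in> pairs n \<Longrightarrow>
    gen (j, k) * gen (i, j) - (gen (i, j) * gen (i, k) + gen (i, k) * gen (j, k) - gen (i, k))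
      \<in> D_relators n"
proof -
  assume *: "(i, j) \<in> pairs n"
  show "gen (i, j) * gen (i, j) - gen (i, j) \<in> D_relators n"
    unfolding D_relators_def Let_def power2_eq_square
    by (rule UnI1, rule UnI1, rule UnI1) (use * in blast)
next
  assume *: "(i, j) \<in> pairs n" "(k, l) \<in> pairs n" "{i, j} \<inter> {k, l} = {}"
  show "gen (i, j) * gen (k, l) - gen (k, l) * gen (i, j) \<in> D_relators n"
    unfolding D_relators_def Let_def by (rule UnI1, rule UnI1, rule UnI2) (use * in blast)
next
  assume "(i, j) \<in> pairs n" "(j, k) \<in> pairs n"
  then have *: "1 \<le> i \<and> i < j \<and> j < k \<and> k \<le> n"
    by (simp add: pairs_def)
  show "gen (i, j) * gen (j, k) -
      (gen (i, k) * gen (i, j) + gen (j, k) * gen (i, k) - gen (i, k)) \<in> D_relators n"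
    unfolding D_relators_def Let_def by (rule UnI1, rule UnI2) (use * in blast)
  show "gen (j, k) * gen (i, j) -
      (gen (i, j) * gen (i, k) + gen (i, k) * gen (j, k) - gen (i, k)) \<in> D_relators n"
    unfolding D_relators_def Let_def by (rule UnI2) (use * in blast)
qed

locale D_ideal =
  fixes n :: nat and I :: "(nat \<times> nat) free_alg set"
  assumes ideal: "ideal I (free_ring (pairs n))" and relators: "D_relators n \<subseteq> I"
begin

lemmas closed = ideal_free_ringD[OF ideal]

lemma relator_mems:
  "(i, j) \<in> pairs n \<Longrightarrow> gen (i, j) * gen (i, j) - gen (i, j) \<in> I"
  "(i, j) \<in> pairs n \<Longrightarrow> (k, l) \<in> pairs n \<Longrightarrow> {i, j} \<inter> {k, l} = {} \<Longrightarrow>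
    gen (i, j) * gen (k, l) - gen (k, l) * gen (i, j) \<in> I"
  "(i, j) \<in> pairs n \<Longrightarrow> (j, k) \<in> pairs n \<Longrightarrow>
    gen (i, j) * gen (j, k) - (gen (i, k) * gen (i, j) + gen (j, k) * gen (i, k) - gen (i, k)) \<in> I"
  "(i, j) \<in> pairs n \<Longrightarrow> (j, k) \<in> pairs n \<Longrightarrow>
    gen (j, k) * gen (i, j) - (gen (i, j) * gen (i, k) + gen (i, k) * gen (j, k) - gen (i, k)) \<in> I"
  by (rule subsetD[OF relators], rule D_relators_mems; simp)+

text \<open>Moving \<open>s_i\<close> across a relator leaves, up to sign, a relator times
  \<open>s_i q\<close>. If \<open>(i, Suc i)\<close> does not occur in \<open>r\<close>, the indices
  are just permuted; if it does, the correction terms not containing \<open>s_i q\<close> cancel.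
  The right factor \<open>q\<close> is carried along because \<open>s_op i\<close> is not
  multiplicative.\<close>

lemma s_op_relator:
  assumes i: "i \<in> {1..<n}" and r: "r \<in> D_relators n" and q: "q \<in> carrier (free_ring (pairs n))"
  shows "s_op i (r * q) \<in> I"
proof -
  let ?t = "Transposition.transpose i (Suc i)"
  let ?y = "s_op i q"
  have reduce: "z \<in> I" if "z = p * ?y" "p \<in> I" for z p
    using that closed(7) s_op_closed[OF i q] by simp
  have reduce_neg: "z \<in> I" if "z = - (p * ?y)" "p \<in> I" for z p
    using that closed(4,7) s_op_closed[OF i q] by simp
  have t_pairs: "(?t j, ?t k) \<in> pairs n" if "(j, k) \<in> pairs n" "(j, k) \<noteq> (i, Suc i)" for j k
    using transpose_Suc_pairs[OF that i] .
  \<comment> \<open>The outer pair \<open>(j, l)\<close> is never \<open>(i, Suc i)\<close>, since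
    \<open>k\<close> lies strictly between \<open>j\<close> and \<open>l\<close>.\<close>
  have triple: "(j = i \<and> k = Suc i) \<or> (k = i \<and> l = Suc i) \<or>
      ((j, k) \<noteq> (i, Suc i) \<and> (k, l) \<noteq> (i, Suc i) \<and> (j, l) \<noteq> (i, Suc i))"
    if "j < k" "k < l" for j k l
    using that by auto
  consider
      (idem) j k where "(j, k) \<in> pairs n" "r = gen (j, k) * gen (j, k) - gen (j, k)"
    | (comm) j k l m where "(j, k) \<in> pairs n" "(l, m) \<in> pairs n" "{j, k} \<inter> {l, m} = {}"
        "r = gen (j, k) * gen (l, m) - gen (l, m) * gen (j, k)"
    | (left) j k l where "1 \<le> j" "j < k" "k < l" "l \<le> n"
        "r = gen (j, k) * gen (k, l) - (gen (j, l) * gen (j, k) + gen (k, l) * gen (j, l) - gen (j, l))"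
    | (right) j k l where "1 \<le> j" "j < k" "k < l" "l \<le> n"
        "r = gen (k, l) * gen (j, k) - (gen (j, k) * gen (j, l) + gen (j, l) * gen (k, l) - gen (j, l))"
    using r unfolding D_relators_def Let_def power2_eq_square by blast
  then show ?thesis
  proof cases
    case idem
    show ?thesis
    proof (cases "(j, k) = (i, Suc i)")
      case True
      show ?thesis
        unfolding idem(2)
        by (rule reduce[OF _ relator_mems(1)[OF idem(1)]])
          (use True in \<open>simp add: s_op_gen_mult algebra_simps\<close>)
    next
      case False
      show ?thesis
        unfolding idem(2)
        by (rule reduce[OF _ relator_mems(1)[OF t_pairs[OF idem(1) False]]])
          (simp add: s_op_gen_mult_neq[OF False] algebra_simps)
    qed
  next
    case comm
    consider "(j, k) = (i, Suc i)" | "(l, m) = (i, Suc i)"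
      | "(j, k) \<noteq> (i, Suc i)" "(l, m) \<noteq> (i, Suc i)"
      by blast
    then show ?thesis
    proof cases
      \<comment> \<open>The disjoint letter is unmoved by the transposition, and the summand
        \<open>- D_i\<close> in the rule for a leading \<open>D_i\<close> reverses the sign of the
        commutator.\<close>
      case 1
      show ?thesis
        unfolding comm(4)
        by (rule reduce_neg[OF _ relator_mems(2)[OF comm(1-3)]])
          (use 1 comm(3) in \<open>simp add: s_op_gen_mult algebra_simps transpose_apply_other\<close>)
    next
      case 2
      show ?thesis
        unfolding comm(4)
        by (rule reduce_neg[OF _ relator_mems(2)[OF comm(1-3)]])
          (use 2 comm(3) in \<open>simp add: s_op_gen_mult algebra_simps transpose_apply_other\<close>)
    next
      case 3
      have disj: "{?t j, ?t k} \<inter> {?t l, ?t m} = {}"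
        using comm(3) by (auto dest: injD[OF inj_transpose])
      show ?thesis
        unfolding comm(4)
        by (rule reduce[OF _ relator_mems(2)[OF t_pairs[OF comm(1) 3(1)] t_pairs[OF comm(2) 3(2)] disj]])
          (simp add: s_op_gen_mult_neq[OF 3(1)] s_op_gen_mult_neq[OF 3(2)] algebra_simps)
    qed
  next
    case left
    then have mem: "(j, k) \<in> pairs n" "(k, l) \<in> pairs n"
      by (auto simp: pairs_def)
    show ?thesis
      using triple[OF left(2,3)]
    proof (elim disjE)
      assume "(j, k) \<noteq> (i, Suc i) \<and> (k, l) \<noteq> (i, Suc i) \<and> (j, l) \<noteq> (i, Suc i)"
      then have *: "(j, k) \<noteq> (i, Suc i)" "(k, l) \<noteq> (i, Suc i)" "(j, l) \<noteq> (i, Suc i)"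
        by simp_all
      show ?thesis
        unfolding left(5)
        by (rule reduce[OF _ relator_mems(3)[OF t_pairs[OF mem(1) *(1)] t_pairs[OF mem(2) *(2)]]])
          (simp add: *[THEN s_op_gen_mult_neq] algebra_simps)
    next
      \<comment> \<open>Exchanging two neighbouring indices turns one triangle relation into the
        other, hence the appeal to the opposite family.\<close>
      assume "j = i \<and> k = Suc i"
      then show ?thesis
        unfolding left(5)
        by (intro reduce[OF _ relator_mems(4)[OF mem]])
          (use left(3) in \<open>simp add: s_op_gen_mult algebra_simps transpose_apply_other\<close>)
    next
      assume "k = i \<and> l = Suc i"
      then show ?thesis
        unfolding left(5)
        by (intro reduce[OF _ relator_mems(4)[OF mem]])
          (use left(2) in \<open>simp add: s_op_gen_mult algebra_simps transpose_apply_other\<close>)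
    qed
  next
    case right
    then have mem: "(j, k) \<in> pairs n" "(k, l) \<in> pairs n"
      by (auto simp: pairs_def)
    show ?thesis
      using triple[OF right(2,3)]
    proof (elim disjE)
      assume "(j, k) \<noteq> (i, Suc i) \<and> (k, l) \<noteq> (i, Suc i) \<and> (j, l) \<noteq> (i, Suc i)"
      then have *: "(j, k) \<noteq> (i, Suc i)" "(k, l) \<noteq> (i, Suc i)" "(j, l) \<noteq> (i, Suc i)"
        by simp_all
      show ?thesis
        unfolding right(5)
        by (rule reduce[OF _ relator_mems(4)[OF t_pairs[OF mem(1) *(1)] t_pairs[OF mem(2) *(2)]]])
          (simp add: *[THEN s_op_gen_mult_neq] algebra_simps)
    next
      assume "j = i \<and> k = Suc i"
      then show ?thesis
        unfolding right(5)
        by (intro reduce[OF _ relator_mems(3)[OF mem]])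
          (use right(3) in \<open>simp add: s_op_gen_mult algebra_simps transpose_apply_other\<close>)
    next
      assume "k = i \<and> l = Suc i"
      then show ?thesis
        unfolding right(5)
        by (intro reduce[OF _ relator_mems(3)[OF mem]])
          (use right(2) in \<open>simp add: s_op_gen_mult algebra_simps transpose_apply_other\<close>)
    qed
  qed
qed

lemma s_op_ideal:
  assumes i: "i \<in> {1..<n}" and p: "p \<in> Idl\<^bsub>free_ring (pairs n)\<^esub> (D_relators n)"
  shows "s_op i p \<in> I"
proof -
  \<comment> \<open>The quantifier over right factors makes \<open>?K\<close> stable under right
    multiplication. Membership in \<open>I\<close> absorbs the correction \<open>x * (p * q)\<close>
    that appears when \<open>s_i\<close> passes a leading \<open>D_i\<close> on the left.\<close>
  let ?K = "{p \<in> I. \<forall>q \<in> carrier (free_ring (pairs n)). s_op i (p * q) \<in> I}"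
  have "ideal ?K (free_ring (pairs n))"
  proof (rule ideal_free_ringI)
    fix p x
    assume p: "p \<in> ?K" and x: "x \<in> carrier (free_ring (pairs n))"
    show "p * x \<in> ?K"
      using p x closed(7) by (simp add: mult.assoc free_ring_closed)
    have "s_op i (x * (p * q)) \<in> I" if q: "q \<in> carrier (free_ring (pairs n))" for q
      using x
    proof (induction rule: free_ring_induct)
      case one
      then show ?case
        using p q by simp
    next
      case (gen_mult z x)
      obtain j k where z: "z = (j, k)"
        by (cases z)
      have "x * (p * q) \<in> I"
        using gen_mult p q closed(6,7) by simp
      then show ?case
        using gen_mult transpose_Suc_pairs[of j k n i] i
        by (auto simp: z mult.assoc s_op_gen_mult intro!: closed(5,6) simp: free_ring_closed)
    next
      case (diff x y)
      then show ?case
        using closed(5) by (simp add: left_diff_distrib)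
    qed
    then show "x * p \<in> ?K"
      using p x closed(6) by (simp add: mult.assoc)
  qed (use closed in \<open>auto simp: left_diff_distrib\<close>)
  moreover have "D_relators n \<subseteq> ?K"
    using relators s_op_relator[OF i] by blast
  ultimately have "Idl\<^bsub>free_ring (pairs n)\<^esub> (D_relators n) \<subseteq> ?K"
    by (intro Idl_free_ring_subset)
  then have "s_op i (p * 1) \<in> I"
    using p free_ring_closed(2) by blast
  then show ?thesis
    by simp
qed

end

lemma D_ideal_Idl: "D_ideal n (Idl\<^bsub>free_ring (pairs n)\<^esub> (D_relators n))"
  using ring.genideal_ideal[OF ring_free_ring D_relators_closed]
    ring.genideal_self[OF ring_free_ring D_relators_closed]
  by (rule D_ideal.intro)

section \<open>The relations of \<open>H(S_n)\<close> between operators, modulo the ideal\<close>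

lemma H_act_closed:
  assumes "h \<in> carrier (free_ring (H_gens n))" "y \<in> carrier (free_ring (pairs n))"
  shows "act H_op h y \<in> carrier (free_ring (pairs n))"
  using assms(1)
proof (induction rule: free_ring_induct)
  case (gen_mult x q)
  then show ?case
    using s_op_closed
    by (auto simp: H_gens_def H_act_simps free_ring_closed)
qed (use assms(2) in \<open>simp_all add: free_ring_closed\<close>)

lemma H_act_Idl:
  assumes "h \<in> carrier (free_ring (H_gens n))" "y \<in> Idl\<^bsub>free_ring (pairs n)\<^esub> (D_relators n)"
  shows "act H_op h y \<in> Idl\<^bsub>free_ring (pairs n)\<^esub> (D_relators n)"
proof -
  interpret D_ideal n "Idl\<^bsub>free_ring (pairs n)\<^esub> (D_relators n)"
    by (rule D_ideal_Idl)
  show ?thesis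
    using assms(1)
  proof (induction rule: free_ring_induct)
    case (gen_mult x q)
    then show ?case
      using s_op_ideal
      by (auto simp: H_gens_def H_act_simps free_ring_closed intro!: closed(6))
  qed (use assms(2) closed(5) in simp_all)
qed

text \<open>Most relators act as zero already on the free algebra. Idempotency and commutation of
  the \<open>D_i\<close> act as left multiplication by the corresponding relators; the last relation
  for neighbouring indices acts as minus a triangle relator applied to \<open>s_i y\<close>.\<close>

lemma H_act_relator:
  assumes "r \<in> H_relators n" and y: "y \<in> carrier (free_ring (pairs n))"
  shows "act H_op r y \<in> Idl\<^bsub>free_ring (pairs n)\<^esub> (D_relators n)" (is "_ \<in> ?I")
proof -
  interpret D_ideal n ?I
    by (rule D_ideal_Idl)
  have inv: "s_op i (s_op i z) = z" if "i \<in> {1..<n}" "z \<in> carrier (free_ring (pairs n))" for i z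
    using s_op_involution that .
  have commute: "s_op j (s_op i y) = s_op i (s_op j y)" if "\<bar>int i - int j\<bar> > 1" for i j
  proof -
    have "i + 1 < j \<or> j + 1 < i"
      using that by linarith
    then show ?thesis
      using s_op_commute[OF _ y] by metis
  qed
  consider
      i where "i \<in> {1..<n}" "r = gen (S i) ^ 2 - 1 \<or>
        r = (gen (S i) * gen (D i) + gen (D i) * gen (S i)) - (gen (S i) - 1) \<or>
        r = gen (D i) ^ 2 - gen (D i)"
    | i j where "i \<in> {1..<n}" "j \<in> {1..<n}" "\<bar>int i - int j\<bar> > 1"
        "r = gen (S j) * gen (S i) - gen (S i) * gen (S j) \<or>
         r = gen (D j) * gen (S i) - gen (S i) * gen (D j) \<or>
         r = gen (D j) * gen (D i) - gen (D i) * gen (D j)"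
    | i j where "i \<in> {1..<n}" "j \<in> {1..<n}" "\<bar>int i - int j\<bar> = 1"
        "r = gen (S j) * gen (S i) * gen (S j) - gen (S i) * gen (S j) * gen (S i) \<or>
         r = gen (D i) * gen (S j) * gen (S i) - gen (S j) * gen (S i) * gen (D j) \<or>
         r = gen (D j) * gen (S i) * gen (D j) -
           (gen (S i) * gen (D j) * gen (D i) + gen (D i) * gen (D j) * gen (S i)
             + gen (S i) * gen (D j) * gen (S i))"
    using assms(1) unfolding H_relators_def Let_def by blast
  then show ?thesis
  proof cases
    case (1 i)
    have "act H_op r y = 0 \<or> act H_op r y = (gen (i, Suc i) * gen (i, Suc i) - gen (i, Suc i)) * y"
      using 1(2)
      by (elim disjE; hypsubst;
          simp add: H_act_simps power2_eq_square inv[OF 1(1) y] s_op_gen_mult algebra_simps)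
    then show ?thesis
      using closed(2) closed(7)[OF relator_mems(1) y] 1(1) by auto
  next
    case (2 i j)
    have far: "j \<noteq> i" "j \<noteq> Suc i" "Suc j \<noteq> i" "Suc j \<noteq> Suc i"
      using 2(3) by auto
    have "gen (j, Suc j) * gen (i, Suc i) - gen (i, Suc i) * gen (j, Suc j) \<in> ?I"
      by (rule relator_mems(2)) (use 2(1,2) far in auto)
    moreover have "act H_op r y = 0 \<or>
        act H_op r y = (gen (j, Suc j) * gen (i, Suc i) - gen (i, Suc i) * gen (j, Suc j)) * y"
      using 2(4)
      by (elim disjE; hypsubst; simp add: far far[symmetric] H_act_simps commute[OF 2(3)]
          s_op_gen_mult transpose_apply_other algebra_simps)
    ultimately show ?thesis
      using closed(2) closed(7)[OF _ y] by metis
  next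
    case (3 i j)
    have closed_i: "s_op i y \<in> carrier (free_ring (pairs n))"
      by (rule s_op_closed[OF 3(1) y])
    have mems: "gen (i, Suc i) * gen (Suc i, Suc (Suc i)) - (gen (i, Suc (Suc i)) * gen (i, Suc i)
          + gen (Suc i, Suc (Suc i)) * gen (i, Suc (Suc i)) - gen (i, Suc (Suc i))) \<in> ?I"
        "gen (Suc i, Suc (Suc i)) * gen (i, Suc i) - (gen (i, Suc i) * gen (i, Suc (Suc i))
          + gen (i, Suc (Suc i)) * gen (Suc i, Suc (Suc i)) - gen (i, Suc (Suc i))) \<in> ?I"
      if "i \<in> {1..<n}" "Suc i \<in> {1..<n}" for i
      using relator_mems(3,4)[of i "Suc i" "Suc (Suc i)"] that by simp_all
    have "j = Suc i \<or> i = Suc j"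
      using 3(3) by linarith
    then show ?thesis
    proof
      assume j: "j = Suc i"
      \<comment> \<open>Passing \<open>s_i\<close> over \<open>D_j\<close> produces the letter
        \<open>(i, i+2)\<close>. The two terms in which it multiplies \<open>y\<close> itself cancel
        by the involution; what is left is a multiple of \<open>s_i y\<close>.\<close>
      have "act H_op r y = 0 \<or> act H_op r y = - ((gen (i, Suc i) * gen (Suc i, Suc (Suc i))
          - (gen (i, Suc (Suc i)) * gen (i, Suc i)
            + gen (Suc i, Suc (Suc i)) * gen (i, Suc (Suc i)) - gen (i, Suc (Suc i)))) * s_op i y)"
        using 3(4) unfolding j
        by (elim disjE; hypsubst; simp add: s_op_braid[OF 3(1) 3(2)[unfolded j] y] inv[OF 3(1) y]
            H_act_simps s_op_gen_mult transpose_apply_other algebra_simps)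
      then show ?thesis
        using closed(2) closed(4)[OF closed(7)[OF mems(1) closed_i]] 3(1,2) j by metis
    next
      assume i: "i = Suc j"
      \<comment> \<open>With the larger index in the role of \<open>i\<close>, the same computation
        yields the other triangle relator.\<close>
      have "act H_op r y = 0 \<or> act H_op r y = - ((gen (Suc j, Suc (Suc j)) * gen (j, Suc j)
          - (gen (j, Suc j) * gen (j, Suc (Suc j))
            + gen (j, Suc (Suc j)) * gen (Suc j, Suc (Suc j)) - gen (j, Suc (Suc j)))) * s_op i y)"
        using 3(4) unfolding i
        by (elim disjE; hypsubst; simp add: s_op_braid[OF 3(2) 3(1)[unfolded i] y] inv[OF 3(1)[unfolded i] y]
            H_act_simps s_op_gen_mult transpose_apply_other algebra_simps)
      then show ?thesis
        using closed(2) closed(4)[OF closed(7)[OF mems(2) closed_i]] 3(1,2) i by metis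
    qed
  qed
qed

text \<open>The elements that send the whole carrier into \<open>?I\<close> form a two-sided ideal:
  left multiples because operators preserve \<open>?I\<close>, right multiples because they preserve
  the carrier. Hence the action descends to \<open>H(S_n)\<close> on the presented algebra.\<close>

lemma H_act_ideal:
  assumes h: "h \<in> Idl\<^bsub>free_ring (H_gens n)\<^esub> (H_relators n)" and y: "y \<in> carrier (free_ring (pairs n))"
  shows "act H_op h y \<in> Idl\<^bsub>free_ring (pairs n)\<^esub> (D_relators n)" (is "_ \<in> ?I")
proof -
  interpret D_ideal n ?I
    by (rule D_ideal_Idl)
  let ?J = "{h \<in> carrier (free_ring (H_gens n)).
    \<forall>y \<in> carrier (free_ring (pairs n)). act H_op h y \<in> ?I}"
  have "ideal ?J (free_ring (H_gens n))"
    by (rule ideal_free_ringI)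
      (auto simp: free_ring_closed H_act_simps H_act_Idl H_act_closed intro: closed(2,5))
  moreover have "H_relators n \<subseteq> ?J"
    using H_act_relator H_relators_closed by blast
  ultimately show ?thesis
    using Idl_free_ring_subset h y by blast
qed

text \<open>\<open>D_word i k\<close> represents \<open>D\<^sub>i\<^sub>,\<^sub>j\<close> with \<open>j = i + k + 1\<close>.\<close>

primrec D_word :: "nat \<Rightarrow> nat \<Rightarrow> hgen free_alg" where
  "D_word i 0 = gen (D i)"
| "D_word i (Suc k) = gen (S (i + Suc k)) * D_word i k * gen (S (i + Suc k))"

text \<open>The offset \<open>j - i - 1\<close> is zero for adjacent indices, where the word is the
  single letter \<open>D i\<close>.\<close>

definition D_lift :: "nat \<times> nat \<Rightarrow> hgen free_alg" where
  "D_lift p = D_word (fst p) (snd p - Suc (fst p))"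

section \<open>Injectivity of the lift into \<open>H(S_n)\<close>\<close>

lemma D_word_closed: "1 \<le> i \<Longrightarrow> i + k < n \<Longrightarrow> D_word i k \<in> carrier (free_ring (H_gens n))"
  by (induction k) (auto simp: H_gens_def intro!: free_ring_closed(7) simp: free_ring_closed(1))

lemma D_lift_closed: "p \<in> pairs n \<Longrightarrow> D_lift p \<in> carrier (free_ring (H_gens n))"
  unfolding D_lift_def by (rule D_word_closed) (auto simp: pairs_def)

text \<open>In \<open>s_j D_ij s_j\<close> the outer \<open>s_j\<close> shifts the letter to
  \<open>(i, j+1)\<close> and then meets the inner one, which it cancels by the involution.\<close>

lemma act_D_word:
  assumes "1 \<le> i" "i + k < n" "y \<in> carrier (free_ring (pairs n))"
  shows "act H_op (D_word i k) y = gen (i, Suc (i + k)) * y"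
  using assms
proof (induction k arbitrary: y)
  case 0
  then show ?case
    by (simp add: H_act_simps)
next
  case (Suc k)
  then have "s_op (i + Suc k) y \<in> carrier (free_ring (pairs n))"
    by (intro s_op_closed) simp_all
  with Suc show ?case
    using s_op_involution[of "i + Suc k" n y]
    by (simp add: H_act_simps s_op_gen_mult transpose_apply_other)
qed

lemma act_D_lift:
  assumes "p \<in> pairs n" "y \<in> carrier (free_ring (pairs n))"
  shows "act H_op (D_lift p) y = gen p * y"
  using act_D_word[of "fst p" "snd p - Suc (fst p)" n y] assms by (auto simp: pairs_def D_lift_def)

lemma act_subst_D_lift:
  assumes "p \<in> carrier (free_ring (pairs n))" "y \<in> carrier (free_ring (pairs n))"
  shows "act H_op (subst_alg D_lift p) y = p * y"
  using assms(1)
proof (induction rule: free_ring_induct)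
  case (gen_mult x q)
  then show ?case
    using assms(2) by (simp add: H_act_simps act_D_lift free_ring_closed mult.assoc)
qed (simp_all add: left_diff_distrib)

text \<open>Acting on \<open>1\<close> recovers \<open>p\<close> from its lift.\<close>

lemma subst_D_lift_inj:
  assumes "p \<in> carrier (free_ring (pairs n))"
    and "subst_alg D_lift p \<in> Idl\<^bsub>free_ring (H_gens n)\<^esub> (H_relators n)"
  shows "p \<in> Idl\<^bsub>free_ring (pairs n)\<^esub> (D_relators n)"
  using H_act_ideal[OF assms(2) free_ring_closed(2)] act_subst_D_lift[OF assms(1) free_ring_closed(2)]
  by simp

section \<open>Homomorphisms out of the symmetric group\<close>

lemma permutes_atLeastAtMost_last:
  assumes "w permutes {a..b::nat}" "w b = b"
  shows "w permutes {a..b - 1}"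
proof (rule permutes_superset[OF assms(1)])
  fix x
  assume "x \<in> {a..b} - {a..b - 1}"
  then have "x = b"
    by auto
  then show "w x = x"
    using assms(2) by simp
qed

lemma adjacent_permutes:
  assumes "a \<le> i" "i < b" "w permutes {a..b::nat}"
  shows "Transposition.transpose i (Suc i) \<circ> w permutes {a..b}"
  by (intro permutes_compose assms(3) permutes_swap_id) (use assms(1,2) in auto)

text \<open>A sorting argument: the value at the last point is raised in unit steps until the point
  is fixed, and then the interval is shortened. The lower end is arbitrary so that the stabilizer of
  1 and 2 is covered as well.\<close>

lemma permutes_adjacent_induct [consumes 1, case_names id adjacent]:
  fixes a b :: nat
  assumes "w permutes {a..b}"
    and id: "P id"
    and adjacent: "\<And>i w. a \<le> i \<Longrightarrow> i < b \<Longrightarrow> w permutes {a..b} \<Longrightarrow> P w \<Longrightarrow>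
      P (Transposition.transpose i (Suc i) \<circ> w)"
  shows "P w"
  using assms(1)
proof -
  have "P w" if "w permutes {a..m}" "m \<le> b" for m w
    using that
  proof (induction m arbitrary: w)
    case 0
    then have "w = id"
      by (metis atLeastAtMost_singleton_iff atLeastatMost_empty_iff2 le_zero_eq not_gr_zero
          permutes_empty permutes_sing)
    then show ?case
      using id by metis
  next
    case (Suc m)
    show ?case
      using Suc.prems
    proof (induction "Suc m - w (Suc m)" arbitrary: w rule: less_induct)
      case less
      show ?case
      proof (cases "w (Suc m) < Suc m")
        case False
        have "w (Suc m) = Suc m"
        \<comment> \<open>For \<open>a > Suc m\<close> the interval is empty and \<open>w\<close>
          fixes every point.\<close>
        proof (cases "a \<le> Suc m")
          case True
          then show ?thesis
            using permutes_in_image[OF less.prems(1), of "Suc m"] False by auto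
        qed (use permutes_not_in[OF less.prems(1)] in auto)
        then show ?thesis
          using permutes_atLeastAtMost_last[OF less.prems(1)] Suc.IH less.prems(2) by simp
      next
        case True
        let ?k = "w (Suc m)"
        let ?v = "Transposition.transpose ?k (Suc ?k) \<circ> w"
        have "Suc m \<in> {a..Suc m}"
          using True permutes_not_in[OF less.prems(1), of "Suc m"] by force
        then have k: "a \<le> ?k"
          using permutes_in_image[OF less.prems(1), of "Suc m"] by simp
        \<comment> \<open>The permutation \<open>?v\<close> is one step closer to fixing
          \<open>Suc m\<close>; the same transposition leads back from it to
          \<open>w\<close>.\<close>
        have w: "Transposition.transpose ?k (Suc ?k) \<circ> ?v = w"
          by (simp add: o_assoc)
        have v: "?v permutes {a..Suc m}"
          by (rule adjacent_permutes[OF k True less.prems(1)])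
        moreover have "?v (Suc m) = Suc ?k"
          by simp
        ultimately have "P ?v"
          using less.hyps[of ?v] less.prems(2) True by simp
        moreover have "?v permutes {a..b}"
          using v permutes_subset[of ?v "{a..Suc m}"] less.prems(2) by simp
        ultimately have "P (Transposition.transpose ?k (Suc ?k) \<circ> ?v)"
          using adjacent[OF k] True less.prems(2) by simp
        then show ?thesis
          unfolding w .
      qed
    qed
  qed
  then show ?thesis
    using assms(1) by blast
qed

section \<open>Homomorphisms from the Coxeter relations, by evaluating chosen words\<close>

lemma adjacent_braid:
  "Transposition.transpose (Suc k) (Suc (Suc k)) \<circ> (Transposition.transpose k (Suc k) \<circ>
      (Transposition.transpose (Suc k) (Suc (Suc k)) \<circ> w)) =
    Transposition.transpose k (Suc k) \<circ> (Transposition.transpose (Suc k) (Suc (Suc k)) \<circ>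
      (Transposition.transpose k (Suc k) \<circ> w))"
  by (rule ext) (simp add: Transposition.transpose_def)

lemma adjacent_commute:
  assumes "i + 1 < j \<or> j + 1 < i"
  shows "Transposition.transpose i (Suc i) \<circ> (Transposition.transpose j (Suc j) \<circ> w) =
    Transposition.transpose j (Suc j) \<circ> (Transposition.transpose i (Suc i) \<circ> w)"
  by (rule ext) (use assms in \<open>auto simp: Transposition.transpose_def\<close>)

locale coxeter_images = group G for G (structure) +
  fixes s :: "nat \<Rightarrow> 'a" and n :: nat
  assumes s_closed: "i \<in> {1..<n} \<Longrightarrow> s i \<in> carrier G"
    and s_square: "i \<in> {1..<n} \<Longrightarrow> s i \<otimes> s i = \<one>"
    and s_commute: "i \<in> {1..<n} \<Longrightarrow> j \<in> {1..<n} \<Longrightarrow> i + 1 < j \<Longrightarrow> s i \<otimes> s j = s j \<otimes> s i"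
    and s_braid: "i \<in> {1..<n} \<Longrightarrow> Suc i \<in> {1..<n} \<Longrightarrow>
      s i \<otimes> (s (Suc i) \<otimes> s i) = s (Suc i) \<otimes> (s i \<otimes> s (Suc i))"
begin

text \<open>Evaluates the reduced word of \<open>w\<close> obtained by sorting the values \<open>w m\<close>, \<open>w (m - 1)\<close>, \<dots>
  into place.\<close>

function img :: "nat \<Rightarrow> (nat \<Rightarrow> nat) \<Rightarrow> 'a" where
  "img m w =
    (if m = 0 then \<one>
     else if w m < m then s (w m) \<otimes> img m (Transposition.transpose (w m) (Suc (w m)) \<circ> w)
     else img (m - 1) w)"
  by auto
termination
  \<comment> \<open>The transposition raises \<open>w m\<close> by one as long as it is below
    \<open>m\<close>; afterwards \<open>m\<close> itself drops.\<close>
  by (relation "measures [\<lambda>(m, w). m, \<lambda>(m, w). m - w m]") auto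

declare img.simps [simp del]

lemma img_0: "img 0 w = \<one>"
  by (subst img.simps) simp

lemma img_lt:
  "w m < m \<Longrightarrow> img m w = s (w m) \<otimes> img m (Transposition.transpose (w m) (Suc (w m)) \<circ> w)"
  by (subst img.simps) simp

lemma img_fixed: "w (Suc m) = Suc m \<Longrightarrow> img (Suc m) w = img m w"
  by (subst img.simps) simp

lemma last_image:
  assumes "w permutes {1..Suc m}"
  shows "w (Suc m) \<in> {1..Suc m}"
  using permutes_in_image[OF assms, of "Suc m"] by simp

lemma img_closed: "w permutes {1..m} \<Longrightarrow> m \<le> n \<Longrightarrow> img m w \<in> carrier G"
proof (induction m w rule: img.induct)
  case (1 m w)
  show ?case
  proof (cases m)
    case 0
    then show ?thesis
      by (simp add: img_0)
  next
    case (Suc l)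
    then have mem: "w m \<in> {1..m}"
      using last_image 1 by simp
    show ?thesis
    proof (cases "w m < m")
      case True
      have "img m (Transposition.transpose (w m) (Suc (w m)) \<circ> w) \<in> carrier G"
        using mem "1.prems"
        by (intro "1.IH"(1)[OF _ True adjacent_permutes[OF _ True]]) simp_all
      then show ?thesis
        using True mem s_closed "1.prems"(2) by (subst img_lt) simp_all
    next
      case False
      then have "w m = m"
        using mem by simp
      then show ?thesis
        using 1 False Suc permutes_atLeastAtMost_last[of w 1 m] by (simp add: img_fixed)
    qed
  qed
qed

text \<open>The chosen words for \<open>w\<close> and for the composite are compared by the position
  of \<open>i\<close> relative to the current last value \<open>k\<close>. Only
  \<open>i = Suc k\<close> needs the braid relation; elsewhere the factors agree, cancel or commute,
  or the claim passes to a smaller \<open>m\<close>.\<close>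

lemma img_adjacent:
  assumes "w permutes {1..m}" "m \<le> n" "1 \<le> i" "i < m"
  shows "img m (Transposition.transpose i (Suc i) \<circ> w) = s i \<otimes> img m w"
  using assms
proof (induction m arbitrary: w i)
  case 0
  then show ?case
    by simp
next
  case (Suc m)
  show ?case
    using Suc.prems
  proof (induction "Suc m - w (Suc m)" arbitrary: w i rule: less_induct)
    case (less w i)
    define \<tau> where "\<tau> j = Transposition.transpose j (Suc j)" for j :: nat
    have \<tau>_simps: "\<tau> j j = Suc j" "\<tau> j (Suc j) = j" "\<tau> j \<circ> (\<tau> j \<circ> v) = v" for j v
      by (simp_all add: \<tau>_def o_assoc)
    have \<tau>_other: "\<tau> j x = x" if "x \<noteq> j" "x \<noteq> Suc j" for j x
      using that by (simp add: \<tau>_def)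
    have perm: "\<tau> j \<circ> v permutes {1..Suc m}" if "1 \<le> j" "j \<le> m" "v permutes {1..Suc m}" for j v
      unfolding \<tau>_def using adjacent_permutes that by simp
    have gens: "s j \<in> carrier G" "s j \<otimes> s j = \<one>" if "1 \<le> j" "j \<le> m" for j
      using s_closed s_square that less.prems(2) by simp_all
    have lt: "img (Suc m) v = s (v (Suc m)) \<otimes> img (Suc m) (\<tau> (v (Suc m)) \<circ> v)"
      if "v (Suc m) < Suc m" for v
      unfolding \<tau>_def using img_lt[of v "Suc m"] that .
    have closed: "img (Suc m) v \<in> carrier G" if "v permutes {1..Suc m}" for v
      using img_closed that less.prems(2) .
    note IH = less.hyps[folded \<tau>_def, OF _ _ less.prems(2)]
    define k where "k = w (Suc m)"
    have k: "1 \<le> k" "k \<le> Suc m"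
      using last_image[OF less.prems(1)] by (simp_all add: k_def)
    have w: "w permutes {1..Suc m}" and i: "1 \<le> i" "i \<le> m"
      using less.prems by simp_all
    consider "Suc i = k" | "i = k" | "Suc i < k" "k = Suc m" | "Suc i < k" "k \<le> m"
      | "i = Suc k" | "Suc k < i"
      using k by linarith
    then have "img (Suc m) (\<tau> i \<circ> w) = s i \<otimes> img (Suc m) w"
    proof cases
      \<comment> \<open>The transposition lowers the last value from \<open>k\<close> to
        \<open>i\<close>, so the first unfolding step of \<open>img\<close> restores
        \<open>w\<close>.\<close>
      case 1
      then show ?thesis
        using i by (subst lt) (simp_all add: k_def[symmetric] \<tau>_simps flip: 1)
    next
      \<comment> \<open>Here \<open>s i\<close> is the first factor of \<open>img (Suc m) w\<close>,
        and multiplying by \<open>s i\<close> once more removes it.\<close>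
      case 2
      then have "img (Suc m) w = s i \<otimes> img (Suc m) (\<tau> i \<circ> w)"
        using i lt[of w] by (simp add: k_def)
      then show ?thesis
        using gens[OF i] closed[OF perm[OF i w]] by (simp flip: m_assoc)
    next
      \<comment> \<open>The last point is fixed on both sides, so the outer induction on
        \<open>m\<close> applies.\<close>
      case 3
      then have "\<tau> i k = k"
        by (intro \<tau>_other) auto
      moreover have "img m (\<tau> i \<circ> w) = s i \<otimes> img m w"
        unfolding \<tau>_def
        by (rule Suc.IH)
          (use 3 permutes_atLeastAtMost_last[OF w] i less.prems(2) in \<open>simp_all add: k_def\<close>)
      ultimately show ?thesis
        using 3 by (simp add: img_fixed k_def)
    next
      \<comment> \<open>The swap at \<open>i\<close> does not touch \<open>k\<close>, and both the
        transpositions and the factors \<open>s i\<close>, \<open>s k\<close> commute.\<close>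
      case 4
      have "\<tau> i k = k"
        using 4 by (intro \<tau>_other) auto
      then have "img (Suc m) (\<tau> i \<circ> w) = s k \<otimes> img (Suc m) (\<tau> k \<circ> (\<tau> i \<circ> w))"
        using 4 lt[of "\<tau> i \<circ> w"] by (simp add: k_def)
      also have "\<tau> k \<circ> (\<tau> i \<circ> w) = \<tau> i \<circ> (\<tau> k \<circ> w)"
        unfolding \<tau>_def using 4 by (intro adjacent_commute) simp
      also have "img (Suc m) \<dots> = s i \<otimes> img (Suc m) (\<tau> k \<circ> w)"
        using 4 k i w by (intro IH perm) (simp_all add: k_def[symmetric] \<tau>_simps)
      also have "s k \<otimes> \<dots> = s i \<otimes> (s k \<otimes> img (Suc m) (\<tau> k \<circ> w))"
        using gens[OF i] gens[OF k(1) 4(2)] closed[OF perm[OF k(1) 4(2) w]]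
          s_commute[of i k] 4 i k less.prems(2) by (simp flip: m_assoc)
      also have "s k \<otimes> img (Suc m) (\<tau> k \<circ> w) = img (Suc m) w"
        using lt[of w] 4 by (simp add: k_def)
      finally show ?thesis .
    next
      \<comment> \<open>The value \<open>k\<close> is raised twice. The braid identity of
        permutations exposes \<open>\<tau> (Suc k) \<circ> (\<tau> k \<circ> w)\<close>, whose last
        value is \<open>k + 2\<close>, so the inner hypothesis applies; the braid relation in
        \<open>G\<close> then reorders the factors.\<close>
      case 5
      have k_less: "k \<le> m" "Suc k \<le> m"
        using 5 i by simp_all
      have closed': "img (Suc m) (\<tau> (Suc k) \<circ> (\<tau> k \<circ> w)) \<in> carrier G"
        using k k_less w by (intro closed perm) simp_all
      have "img (Suc m) (\<tau> (Suc k) \<circ> w) = s k \<otimes> img (Suc m) (\<tau> k \<circ> (\<tau> (Suc k) \<circ> w))"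
        using k_less lt[of "\<tau> (Suc k) \<circ> w"] \<tau>_other[of k "Suc k"] by (simp add: k_def[symmetric])
      also have "img (Suc m) (\<tau> k \<circ> (\<tau> (Suc k) \<circ> w)) =
          s (Suc k) \<otimes> img (Suc m) (\<tau> (Suc k) \<circ> (\<tau> k \<circ> (\<tau> (Suc k) \<circ> w)))"
        using k_less lt[of "\<tau> k \<circ> (\<tau> (Suc k) \<circ> w)"] \<tau>_other[of k "Suc k"]
        by (simp add: k_def[symmetric] \<tau>_simps)
      also have "\<tau> (Suc k) \<circ> (\<tau> k \<circ> (\<tau> (Suc k) \<circ> w)) = \<tau> k \<circ> (\<tau> (Suc k) \<circ> (\<tau> k \<circ> w))"
        unfolding \<tau>_def by (rule adjacent_braid)
      also have "img (Suc m) \<dots> = s k \<otimes> img (Suc m) (\<tau> (Suc k) \<circ> (\<tau> k \<circ> w))"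
        using k k_less w by (intro IH perm) (simp_all add: k_def[symmetric] \<tau>_simps)
      also have "s k \<otimes> (s (Suc k) \<otimes> (s k \<otimes> img (Suc m) (\<tau> (Suc k) \<circ> (\<tau> k \<circ> w)))) =
          s k \<otimes> (s (Suc k) \<otimes> s k) \<otimes> img (Suc m) (\<tau> (Suc k) \<circ> (\<tau> k \<circ> w))"
        using gens[OF k(1) k_less(1)] gens[of "Suc k"] k_less closed' by (simp add: m_assoc)
      also have "s k \<otimes> (s (Suc k) \<otimes> s k) = s (Suc k) \<otimes> (s k \<otimes> s (Suc k))"
        using k k_less less.prems(2) by (intro s_braid) simp_all
      also have "\<dots> \<otimes> img (Suc m) (\<tau> (Suc k) \<circ> (\<tau> k \<circ> w)) =
          s (Suc k) \<otimes> (s k \<otimes> (s (Suc k) \<otimes> img (Suc m) (\<tau> (Suc k) \<circ> (\<tau> k \<circ> w))))"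
        using gens[OF k(1) k_less(1)] gens[of "Suc k"] k_less closed' by (simp add: m_assoc)
      also have "s (Suc k) \<otimes> img (Suc m) (\<tau> (Suc k) \<circ> (\<tau> k \<circ> w)) = img (Suc m) (\<tau> k \<circ> w)"
        using k_less lt[of "\<tau> k \<circ> w"] by (simp add: k_def[symmetric] \<tau>_simps)
      also have "s k \<otimes> \<dots> = img (Suc m) w"
        using k_less lt[of w] by (simp add: k_def)
      finally show ?thesis
        unfolding 5 .
    next
      case 6
      have "\<tau> i k = k"
        using 6 by (intro \<tau>_other) auto
      then have "img (Suc m) (\<tau> i \<circ> w) = s k \<otimes> img (Suc m) (\<tau> k \<circ> (\<tau> i \<circ> w))"
        using 6 i lt[of "\<tau> i \<circ> w"] by (simp add: k_def)
      also have "\<tau> k \<circ> (\<tau> i \<circ> w) = \<tau> i \<circ> (\<tau> k \<circ> w)"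
        unfolding \<tau>_def using 6 by (intro adjacent_commute) simp
      also have "img (Suc m) \<dots> = s i \<otimes> img (Suc m) (\<tau> k \<circ> w)"
        using 6 k i w by (intro IH perm) (simp_all add: k_def[symmetric] \<tau>_simps)
      also have "s k \<otimes> \<dots> = s i \<otimes> (s k \<otimes> img (Suc m) (\<tau> k \<circ> w))"
        using gens[OF i] gens[OF k(1)] closed[OF perm[OF k(1) _ w]]
          s_commute[of k i] 6 i k less.prems(2) by (simp flip: m_assoc)
      also have "s k \<otimes> img (Suc m) (\<tau> k \<circ> w) = img (Suc m) w"
        using lt[of w] 6 i by (simp add: k_def)
      finally show ?thesis .
    qed
    then show ?case
      by (simp add: \<tau>_def)
  qed
qed

lemma img_id: "img m id = \<one>"
  by (induction m) (simp_all add: img_0 img_fixed)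

lemma img_compose:
  assumes "u permutes {1..n}" "w permutes {1..n}"
  shows "img n (u \<circ> w) = img n u \<otimes> img n w"
  using assms(1)
proof (induction rule: permutes_adjacent_induct)
  case id
  then show ?case
    using img_closed[OF assms(2)] by (simp add: img_id[unfolded id_def] id_def)
next
  case (adjacent i u)
  then have i: "1 \<le> i" "i < n" and u: "u permutes {1..n}" and "s i \<in> carrier G"
    using s_closed by simp_all
  have "img n (Transposition.transpose i (Suc i) \<circ> (u \<circ> w)) = s i \<otimes> img n (u \<circ> w)"
    by (rule img_adjacent[OF permutes_compose[OF assms(2) u] order_refl i])
  also have "\<dots> = s i \<otimes> img n u \<otimes> img n w"
    unfolding adjacent.IH
    by (rule m_assoc[symmetric]) (use img_closed u assms(2) s_closed i in auto)
  also have "s i \<otimes> img n u = img n (Transposition.transpose i (Suc i) \<circ> u)"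
    by (rule img_adjacent[OF u order_refl i, symmetric])
  finally show ?case
    by (simp only: o_assoc)
qed

text \<open>This justifies the definite description of the homomorphism: \<open>img\<close> provides
  existence, and generation by adjacent transpositions provides uniqueness.\<close>

lemma ex1_sym_group_hom:
  "\<exists>!\<phi>. \<phi> \<in> hom (sym_group n) G \<and> \<phi> \<in> extensional (carrier (sym_group n)) \<and>
    (\<forall>i\<in>{1..<n}. \<phi> (Transposition.transpose i (i + 1)) = s i)"
proof -
  let ?P = "\<lambda>\<phi>. \<phi> \<in> hom (sym_group n) G \<and> \<phi> \<in> extensional (carrier (sym_group n)) \<and>
    (\<forall>i\<in>{1..<n}. \<phi> (Transposition.transpose i (i + 1)) = s i)"
  let ?\<phi> = "restrict (img n) (carrier (sym_group n))"
  have "?\<phi> \<in> hom (sym_group n) G"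
    using permutes_compose by (auto simp: hom_def sym_group_def img_closed img_compose)
  moreover have "?\<phi> (Transposition.transpose i (i + 1)) = s i" if "i \<in> {1..<n}" for i
    using img_adjacent[OF permutes_id, of n i] adjacent_permutes[OF _ _ permutes_id, of 1 i n]
      that s_closed by (simp add: sym_group_carrier img_id)
  ultimately have "?P ?\<phi>"
    by simp
  moreover have "\<phi> = \<psi>" if \<phi>: "?P \<phi>" and \<psi>: "?P \<psi>" for \<phi> \<psi>
  proof (rule extensionalityI[of _ "carrier (sym_group n)"])
    fix w
    assume "w \<in> carrier (sym_group n)"
    then have "w permutes {1..n}"
      by (simp add: sym_group_carrier)
    then show "\<phi> w = \<psi> w"
    proof (induction rule: permutes_adjacent_induct)
      case id
      have "\<phi> id = \<one>" "\<psi> id = \<one>"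
        using hom_one[of \<phi> "sym_group n" G] hom_one[of \<psi> "sym_group n" G] \<phi> \<psi>
          sym_group_is_group is_group by (simp_all add: sym_group_one)
      then show ?case
        by metis
    next
      case (adjacent i w)
      then have "Transposition.transpose i (Suc i) \<in> carrier (sym_group n)" "w \<in> carrier (sym_group n)"
        using adjacent_permutes[OF _ _ permutes_id, of 1 i n] by (simp_all add: sym_group_carrier)
      then have "\<phi> (Transposition.transpose i (Suc i) \<circ> w) = s i \<otimes> \<phi> w"
          "\<psi> (Transposition.transpose i (Suc i) \<circ> w) = s i \<otimes> \<psi> w"
        using hom_mult[of \<phi> "sym_group n" G "Transposition.transpose i (Suc i)" w]
          hom_mult[of \<psi> "sym_group n" G "Transposition.transpose i (Suc i)" w] \<phi> \<psi> adjacent(1,2)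
        by (simp_all add: sym_group_mult)
      then show ?case
        unfolding adjacent.IH by metis
    qed
  qed (use \<phi> \<psi> in auto)
  ultimately show ?thesis
    by blast
qed

end

section \<open>The elements \<open>D\<^sub>i\<^sub>j\<close>\<close>

text \<open>A further value \<open>x\<close> is brought to the next position by exchanging that
  position with the preimage of \<open>x\<close>. This lets relations among the \<open>D_ij\<close>
  be reduced to the smallest indices.\<close>

lemma permutes_extend_list:
  assumes "distinct xs" "set xs \<subseteq> {1..n}"
  shows "\<exists>w. w permutes {1..n} \<and> (\<forall>i<length xs. w (Suc i) = xs ! i)"
  using assms
proof (induction xs rule: rev_induct)
  case Nil
  then show ?case
    by (intro exI[of _ id] conjI permutes_id) simp
next
  case (snoc x xs)
  then obtain w where w: "w permutes {1..n}" and nth: "\<And>i. i < length xs \<Longrightarrow> w (Suc i) = xs ! i"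
    by auto
  let ?l = "Suc (length xs)"
  define y where "y = inv_into UNIV w x"
  have y: "w y = x"
    unfolding y_def using w by (simp add: permutes_inverses(1))
  have "card (set (xs @ [x])) \<le> card {1..n}"
    using snoc.prems by (intro card_mono) auto
  then have "?l \<in> {1..n}"
    using distinct_card[OF snoc.prems(1)] by simp
  moreover have "y \<in> {1..n}"
    using permutes_in_image[OF w, of y] y snoc.prems by simp
  ultimately have "w \<circ> Transposition.transpose ?l y permutes {1..n}"
    by (intro permutes_compose permutes_swap_id w)
  moreover have "(w \<circ> Transposition.transpose ?l y) (Suc i) = (xs @ [x]) ! i"
    if i: "i < length (xs @ [x])" for i
  proof (cases "i = length xs")
    case True
    then show ?thesis
      using y by simp
  next
    case False
    then have "i < length xs"
      using i by simp
    \<comment> \<open>If \<open>y\<close> were an earlier position, \<open>x\<close> would occur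
      twice in the list.\<close>
    moreover from this have "y \<noteq> Suc i"
      using nth y snoc.prems(1) by auto
    ultimately show ?thesis
      using nth by (simp add: transpose_apply_other nth_append)
  qed
  ultimately show ?case
    by blast
qed

text \<open>\<open>d_d_adjacent\<close> is the last relation of (3) multiplied by \<open>s\<^sub>i\<close> on the right and rewritten with
  \<open>s\<^sub>iD\<^sub>i + D\<^sub>is\<^sub>i = s\<^sub>i - 1\<close>, which is used nowhere else.\<close>

locale hecke_ring = ring R for R (structure) +
  fixes s d :: "nat \<Rightarrow> 'a" and n :: nat
  assumes s_closed: "i \<in> {1..<n} \<Longrightarrow> s i \<in> carrier R"
    and d_closed: "i \<in> {1..<n} \<Longrightarrow> d i \<in> carrier R"
    and s_square: "i \<in> {1..<n} \<Longrightarrow> s i \<otimes> s i = \<one>"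
    and d_idem: "i \<in> {1..<n} \<Longrightarrow> d i \<otimes> d i = d i"
    and s_s_commute: "i \<in> {1..<n} \<Longrightarrow> j \<in> {1..<n} \<Longrightarrow> i + 1 < j \<Longrightarrow> s i \<otimes> s j = s j \<otimes> s i"
    and s_d_commute: "i \<in> {1..<n} \<Longrightarrow> j \<in> {1..<n} \<Longrightarrow> i + 1 < j \<Longrightarrow> s j \<otimes> d i = d i \<otimes> s j"
    and d_d_commute: "i \<in> {1..<n} \<Longrightarrow> j \<in> {1..<n} \<Longrightarrow> i + 1 < j \<Longrightarrow> d i \<otimes> d j = d j \<otimes> d i"
    and s_braid: "i \<in> {1..<n} \<Longrightarrow> Suc i \<in> {1..<n} \<Longrightarrow>
      s i \<otimes> (s (Suc i) \<otimes> s i) = s (Suc i) \<otimes> (s i \<otimes> s (Suc i))"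
    and d_braid: "i \<in> {1..<n} \<Longrightarrow> Suc i \<in> {1..<n} \<Longrightarrow>
      d i \<otimes> (s (Suc i) \<otimes> s i) = s (Suc i) \<otimes> (s i \<otimes> d (Suc i))"
    and d_d_adjacent: "i \<in> {1..<n} \<Longrightarrow> j \<in> {1..<n} \<Longrightarrow> j = Suc i \<or> i = Suc j \<Longrightarrow>
      d i \<otimes> d j \<oplus> s i \<otimes> d j \<otimes> s i =
        (s i \<otimes> d j \<otimes> s i) \<otimes> d i \<oplus> d j \<otimes> (s i \<otimes> d j \<otimes> s i)"
begin

lemma s_unit: "i \<in> {1..<n} \<Longrightarrow> s i \<in> Units R"
  using s_closed s_square by (auto simp: Units_def)

lemma s_inv: "i \<in> {1..<n} \<Longrightarrow> inv (s i) = s i"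
  using s_closed s_square by (intro inv_char) simp_all

text \<open>Each \<open>s i\<close> is its own inverse, so the target group can be the units of the
  ring.\<close>

sublocale images: coxeter_images "units_of R" s n
proof (rule coxeter_images.intro)
  show "group (units_of R)"
    by (rule units_group)
  show "coxeter_images_axioms (units_of R) s n"
    by unfold_locales
      (use s_unit s_square s_s_commute s_braid in
        \<open>simp_all add: units_of_carrier units_of_mult units_of_one\<close>)
qed

section \<open>Conjugation by permutations and the elements \<open>dd i j\<close>\<close>

definition perm :: "(nat \<Rightarrow> nat) \<Rightarrow> 'a" where
  "perm = (THE \<phi>. \<phi> \<in> hom (sym_group n) (units_of R) \<and> \<phi> \<in> extensional (carrier (sym_group n)) \<and>
    (\<forall>i\<in>{1..<n}. \<phi> (Transposition.transpose i (i + 1)) = s i))"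

lemma perm_hom: "perm \<in> hom (sym_group n) (units_of R)"
  and perm_adjacent: "i \<in> {1..<n} \<Longrightarrow> perm (Transposition.transpose i (Suc i)) = s i"
  using theI'[OF images.ex1_sym_group_hom, folded perm_def] by simp_all

lemma perm_unit: "w permutes {1..n} \<Longrightarrow> perm w \<in> Units R"
  using hom_in_carrier[OF perm_hom, of w] by (simp add: sym_group_carrier units_of_carrier)

lemma perm_compose:
  "u permutes {1..n} \<Longrightarrow> w permutes {1..n} \<Longrightarrow> perm (u \<circ> w) = perm u \<otimes> perm w"
  using hom_mult[OF perm_hom, of u w] by (simp add: sym_group_carrier sym_group_mult units_of_mult)

lemma perm_id: "perm id = \<one>"
  using hom_one[OF perm_hom sym_group_is_group units_group]
  by (simp add: sym_group_one units_of_one)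

definition conjugate :: "(nat \<Rightarrow> nat) \<Rightarrow> 'a \<Rightarrow> 'a" where
  "conjugate w x = perm w \<otimes> x \<otimes> inv (perm w)"

lemma conjugate_closed: "w permutes {1..n} \<Longrightarrow> x \<in> carrier R \<Longrightarrow> conjugate w x \<in> carrier R"
  using perm_unit[of w] by (simp add: conjugate_def Units_closed)

lemma conjugate_add:
  "w permutes {1..n} \<Longrightarrow> x \<in> carrier R \<Longrightarrow> y \<in> carrier R \<Longrightarrow> conjugate w (x \<oplus> y) = conjugate w x \<oplus> conjugate w y"
  using perm_unit[of w] by (simp add: conjugate_def Units_closed l_distr r_distr)

lemma conjugate_mult:
  assumes "w permutes {1..n}" "x \<in> carrier R" "y \<in> carrier R"
  shows "conjugate w (x \<otimes> y) = conjugate w x \<otimes> conjugate w y"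
proof -
  have u: "perm w \<in> carrier R" "inv (perm w) \<in> carrier R" "inv (perm w) \<otimes> perm w = \<one>"
    using perm_unit[OF assms(1)] by (simp_all add: Units_closed)
  have "conjugate w x \<otimes> conjugate w y = perm w \<otimes> x \<otimes> (inv (perm w) \<otimes> perm w) \<otimes> y \<otimes> inv (perm w)"
    using u(1,2) assms(2,3) by (simp add: conjugate_def m_assoc)
  then show ?thesis
    using u assms(2,3) by (simp add: conjugate_def m_assoc)
qed

lemma conjugate_compose:
  assumes "u permutes {1..n}" "w permutes {1..n}" "x \<in> carrier R"
  shows "conjugate (u \<circ> w) x = conjugate u (conjugate w x)"
proof -
  note units = perm_unit[OF assms(1)] perm_unit[OF assms(2)]
  have "inv (perm u \<otimes> perm w) = inv (perm w) \<otimes> inv (perm u)"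
    using group.inv_mult_group[OF units_group, of "perm u" "perm w"] units
    by (simp add: units_of_carrier units_of_mult units_of_inv)
  then show ?thesis
    using units assms(3)
    by (simp add: conjugate_def perm_compose[OF assms(1,2)] m_assoc Units_closed)
qed

lemma conjugate_id: "x \<in> carrier R \<Longrightarrow> conjugate id x = x"
  by (simp add: conjugate_def perm_id[unfolded id_def] id_def)

lemma conjugate_adjacent:
  "i \<in> {1..<n} \<Longrightarrow> conjugate (Transposition.transpose i (Suc i)) x = s i \<otimes> x \<otimes> s i"
  by (simp add: conjugate_def perm_adjacent s_inv)

lemma adjacent: "i \<in> {1..<n} \<Longrightarrow> Transposition.transpose i (Suc i) permutes {1..n}"
  by (rule permutes_swap_id) auto

text \<open>The stabilizer of 1 and 2 is generated by adjacent transpositions of index at least 3,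
  and the corresponding \<open>s i\<close> commute with \<open>d 1\<close>. This is the
  well-definedness of the \<open>D_ij\<close>.\<close>

lemma conjugate_stabilizer:
  assumes "u permutes {1..n}" "u 1 = 1" "u 2 = 2" "2 \<le> n"
  shows "conjugate u (d 1) = d 1"
proof -
  have d1: "d 1 \<in> carrier R"
    using d_closed assms(4) by simp
  have *: "v permutes {1..n}" if "v permutes {3..n}" for v
    by (rule permutes_subset[OF that]) auto
  have "u permutes {3..n}"
  proof (rule permutes_superset[OF assms(1)])
    fix x
    assume "x \<in> {1..n} - {3..n}"
    then have "x = 1 \<or> x = 2"
      by auto
    then show "u x = x"
      using assms(2,3) by auto
  qed
  then show ?thesis
  proof (induction rule: permutes_adjacent_induct)
    case id
    show ?case
      using conjugate_id[OF d1] by metis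
  next
    case (adjacent i w)
    then have i: "i \<in> {1..<n}"
      by simp
    have "conjugate (Transposition.transpose i (Suc i) \<circ> w) (d 1) =
        conjugate (Transposition.transpose i (Suc i)) (conjugate w (d 1))"
      by (rule conjugate_compose[OF hecke_ring.adjacent[OF hecke_ring_axioms i] *[OF adjacent.hyps(3)] d1])
    also have "\<dots> = s i \<otimes> d 1 \<otimes> s i"
      unfolding adjacent.IH by (rule conjugate_adjacent[OF i])
    also have "\<dots> = d 1 \<otimes> (s i \<otimes> s i)"
      using s_d_commute[of 1 i] adjacent.hyps(1) i d1 s_closed[OF i] by (simp add: m_assoc)
    also have "\<dots> = d 1"
      using s_square[OF i] d1 by simp
    finally show ?case .
  qed
qed

text \<open>Ordered pairs with \<open>i > j\<close> are included too, so that equivariance under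
  permutations needs no order condition.\<close>

definition dd :: "nat \<Rightarrow> nat \<Rightarrow> 'a" where
  "dd i j = conjugate (SOME w. w permutes {1..n} \<and> w 1 = i \<and> w 2 = j) (d 1)"

text \<open>Two permutations with the same values at 1 and 2 differ by a right factor from the
  stabilizer, which leaves \<open>d 1\<close> unchanged.\<close>

lemma dd_eq_conjugate:
  assumes w: "w permutes {1..n}" and n: "2 \<le> n"
  shows "dd (w 1) (w 2) = conjugate w (d 1)"
proof -
  define v where "v = (SOME v. v permutes {1..n} \<and> v 1 = w 1 \<and> v 2 = w 2)"
  have v: "v permutes {1..n}" "v 1 = w 1" "v 2 = w 2"
    unfolding v_def by (rule someI2[of _ w], use w in simp, simp)+
  let ?u = "inv_into UNIV v \<circ> w"
  have u: "?u permutes {1..n}"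
    by (rule permutes_compose[OF w permutes_inv[OF v(1)]])
  have fixed: "?u 1 = 1" "?u 2 = 2"
    using permutes_inverses(2)[OF v(1)] v(2,3)[symmetric] by simp_all
  have d1: "d 1 \<in> carrier R"
    using d_closed n by simp
  have "w = v \<circ> ?u"
    using permutes_inv_o(1)[OF v(1)] by (simp add: o_assoc)
  then have "conjugate w (d 1) = conjugate v (conjugate ?u (d 1))"
    using conjugate_compose[OF v(1) u d1] by metis
  then show ?thesis
    using conjugate_stabilizer[OF u fixed n] unfolding dd_def v_def by metis
qed

lemma pair_image:
  assumes "i \<in> {1..n}" "j \<in> {1..n}" "i \<noteq> j"
  obtains w where "w permutes {1..n}" "w 1 = i" "w 2 = j"
  using permutes_extend_list[of "[i, j]" n] assms by (auto simp: less_Suc_eq numeral_2_eq_2)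

lemma two_le: "i \<in> {1..n} \<Longrightarrow> j \<in> {1..n} \<Longrightarrow> i \<noteq> j \<Longrightarrow> 2 \<le> n"
  by auto

lemma dd_closed:
  assumes "i \<in> {1..n}" "j \<in> {1..n}" "i \<noteq> j"
  shows "dd i j \<in> carrier R"
proof -
  obtain w where w: "w permutes {1..n}" "w 1 = i" "w 2 = j"
    by (rule pair_image[OF assms])
  then show ?thesis
    using dd_eq_conjugate[OF w(1)] two_le[OF assms] conjugate_closed d_closed by simp
qed

lemma conjugate_dd:
  assumes u: "u permutes {1..n}" and "i \<in> {1..n}" "j \<in> {1..n}" "i \<noteq> j"
  shows "conjugate u (dd i j) = dd (u i) (u j)"
proof -
  obtain w where w: "w permutes {1..n}" "w 1 = i" "w 2 = j"
    by (rule pair_image[OF assms(2-)])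
  have n: "2 \<le> n"
    by (rule two_le[OF assms(2-)])
  have "conjugate (u \<circ> w) (d 1) = conjugate u (conjugate w (d 1))"
    by (rule conjugate_compose[OF u w(1)]) (use d_closed n in simp)
  then show ?thesis
    using dd_eq_conjugate[OF w(1) n] dd_eq_conjugate[OF permutes_compose[OF w(1) u] n] w(2,3) by simp
qed

text \<open>The composite of the transpositions at \<open>i\<close> and \<open>Suc i\<close> carries
  \<open>(i, i+1)\<close> to \<open>(i+1, i+2)\<close>, and \<open>d_braid\<close> says that the
  corresponding conjugation carries \<open>d i\<close> to \<open>d (Suc i)\<close>.\<close>

lemma dd_adjacent: "i \<in> {1..<n} \<Longrightarrow> dd i (Suc i) = d i"
proof (induction i)
  case 0
  then show ?case
    by simp
next
  case (Suc i)
  show ?case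
  proof (cases "i = 0")
    case True
    then show ?thesis
      using dd_eq_conjugate[of id] conjugate_id[of "d 1"] d_closed[of 1] Suc.prems permutes_id
      by (simp add: numeral_2_eq_2)
  next
    case False
    let ?\<tau> = "\<lambda>i. Transposition.transpose i (Suc i)"
    from False Suc.prems have i: "i \<in> {1..<n}" "Suc i \<in> {1..<n}"
      by simp_all
    note cl = s_closed[OF i(1)] s_closed[OF i(2)] d_closed[OF i(1)] d_closed[OF i(2)]
    have "conjugate (?\<tau> i) (conjugate (?\<tau> (Suc i)) (dd i (Suc i))) = dd (Suc i) (Suc (Suc i))"
      using i by (simp add: conjugate_dd adjacent[simplified] transpose_apply_other)
    moreover have "conjugate (?\<tau> i) (conjugate (?\<tau> (Suc i)) (dd i (Suc i))) =
        s i \<otimes> (s (Suc i) \<otimes> (d i \<otimes> (s (Suc i) \<otimes> s i)))"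
      using i Suc.IH cl by (simp add: conjugate_adjacent m_assoc)
    moreover have "\<dots> = s i \<otimes> (s (Suc i) \<otimes> s (Suc i)) \<otimes> s i \<otimes> d (Suc i)"
      using cl by (simp add: d_braid[OF i] m_assoc)
    ultimately show ?thesis
      using cl i by (simp add: s_square)
  qed
qed

lemma dd_step:
  assumes "1 \<le> i" "i < j" "j < n"
  shows "dd i (Suc j) = s j \<otimes> dd i j \<otimes> s j"
  using conjugate_dd[OF adjacent, of j i j] conjugate_adjacent[of j "dd i j"] assms
  by (simp add: transpose_apply_other)

section \<open>Relations among the \<open>dd i j\<close>, transported from the smallest
  indices\<close>

lemma dd_idem:
  assumes "i \<in> {1..n}" "j \<in> {1..n}" "i \<noteq> j"
  shows "dd i j \<otimes> dd i j = dd i j"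
proof -
  obtain w where w: "w permutes {1..n}" "w 1 = i" "w 2 = j"
    by (rule pair_image[OF assms])
  have n: "1 \<in> {1..<n}"
    using two_le[OF assms] by simp
  show ?thesis
    using dd_eq_conjugate[OF w(1)] n conjugate_mult[OF w(1) d_closed[OF n] d_closed[OF n]] d_idem[OF n] w(2,3)
    by simp
qed

lemma dd_commute:
  assumes "i \<in> {1..n}" "j \<in> {1..n}" "k \<in> {1..n}" "l \<in> {1..n}" "distinct [i, j, k, l]"
  shows "dd i j \<otimes> dd k l = dd k l \<otimes> dd i j"
proof -
  obtain w where w: "w permutes {1..n}" "w 1 = i" "w 2 = j" "w 3 = k" "w 4 = l"
    using permutes_extend_list[of "[i, j, k, l]" n] assms
    by (auto simp: less_Suc_eq numeral_eq_Suc)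
  \<comment> \<open>Four distinct indices force \<open>n\<close> to be at least 4, so that
    \<open>d 3\<close> is among the generators.\<close>
  have "card {i, j, k, l} \<le> card {1..n}"
    using assms by (intro card_mono) auto
  then have n: "4 \<le> n"
    using assms(5) by simp
  then have "dd i j = conjugate w (d 1)" "dd k l = conjugate w (d 3)"
    using conjugate_dd[OF w(1), of 1 2] conjugate_dd[OF w(1), of 3 4] dd_adjacent[of 1] dd_adjacent[of 3] w(2-)
    by (simp_all add: numeral_eq_Suc)
  moreover have "d 1 \<in> carrier R" "d 3 \<in> carrier R" "d 1 \<otimes> d 3 = d 3 \<otimes> d 1"
    using d_closed d_d_commute[of 1 3] n by simp_all
  ultimately show ?thesis
    using conjugate_mult[OF w(1)] by metis
qed

text \<open>After conjugation the indices are 1, 2, 3, and \<open>dd 1 3\<close> equals both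
  \<open>s 1 \<otimes> d 2 \<otimes> s 1\<close> and \<open>s 2 \<otimes> d 1 \<otimes> s 2\<close>.
  The two relations are then \<open>d_d_adjacent\<close> for the index pairs (1, 2) and (2,
  1).\<close>

lemma dd_triangle:
  assumes "1 \<le> i" "i < j" "j < k" "k \<le> n"
  shows "dd i j \<otimes> dd j k \<oplus> dd i k = dd i k \<otimes> dd i j \<oplus> dd j k \<otimes> dd i k"
    and "dd j k \<otimes> dd i j \<oplus> dd i k = dd i k \<otimes> dd j k \<oplus> dd i j \<otimes> dd i k"
proof -
  obtain w where w: "w permutes {1..n}" "w 1 = i" "w 2 = j" "w 3 = k"
    using permutes_extend_list[of "[i, j, k]" n] assms
    by (auto simp: less_Suc_eq numeral_eq_Suc)
  have n: "1 \<in> {1..<n}" "2 \<in> {1..<n}"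
    using assms by auto
  have dds: "dd 1 2 = d 1" "dd 2 3 = d 2"
    using dd_adjacent[OF n(1)] dd_adjacent[OF n(2)] by (simp_all add: numeral_eq_Suc)
  have closed: "dd 1 2 \<in> carrier R" "dd 2 3 \<in> carrier R" "dd 1 3 \<in> carrier R"
    using n by (auto intro: dd_closed)
  have "conjugate (Transposition.transpose 1 (Suc 1)) (dd 2 3) = dd 1 3"
    using conjugate_dd[OF adjacent[OF n(1)], of 2 3] n by (simp add: numeral_eq_Suc)
  moreover have "conjugate (Transposition.transpose 2 (Suc 2)) (dd 1 2) = dd 1 3"
    using conjugate_dd[OF adjacent[OF n(2)], of 1 2] n
    by (simp add: numeral_eq_Suc transpose_apply_other)
  ultimately have x: "s 1 \<otimes> d 2 \<otimes> s 1 = dd 1 3" "s 2 \<otimes> d 1 \<otimes> s 2 = dd 1 3"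
    using conjugate_adjacent[OF n(1), of "d 2"] conjugate_adjacent[OF n(2), of "d 1"]
    unfolding dds by metis+
  have "dd 1 2 \<otimes> dd 2 3 \<oplus> dd 1 3 = dd 1 3 \<otimes> dd 1 2 \<oplus> dd 2 3 \<otimes> dd 1 3"
    and "dd 2 3 \<otimes> dd 1 2 \<oplus> dd 1 3 = dd 1 3 \<otimes> dd 2 3 \<oplus> dd 1 2 \<otimes> dd 1 3"
    using d_d_adjacent[OF n(1,2)] d_d_adjacent[OF n(2,1)] unfolding dds x by simp_all
  then have "conjugate w (dd 1 2) \<otimes> conjugate w (dd 2 3) \<oplus> conjugate w (dd 1 3) =
      conjugate w (dd 1 3) \<otimes> conjugate w (dd 1 2) \<oplus> conjugate w (dd 2 3) \<otimes> conjugate w (dd 1 3)"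
    and "conjugate w (dd 2 3) \<otimes> conjugate w (dd 1 2) \<oplus> conjugate w (dd 1 3) =
      conjugate w (dd 1 3) \<otimes> conjugate w (dd 2 3) \<oplus> conjugate w (dd 1 2) \<otimes> conjugate w (dd 1 3)"
    using closed by (simp_all flip: conjugate_mult[OF w(1)] conjugate_add[OF w(1)])
  moreover have "conjugate w (dd 1 2) = dd i j" "conjugate w (dd 2 3) = dd j k" "conjugate w (dd 1 3) = dd i k"
    using conjugate_dd[OF w(1)] n w(2-) by auto
  ultimately show "dd i j \<otimes> dd j k \<oplus> dd i k = dd i k \<otimes> dd i j \<oplus> dd j k \<otimes> dd i k"
    and "dd j k \<otimes> dd i j \<oplus> dd i k = dd i k \<otimes> dd j k \<oplus> dd i j \<otimes> dd i k"
    by simp_all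
qed

text \<open>Every increasing pair is the image of \<open>(1, 2)\<close> under some permutation, so
  equivariance and the value \<open>d 1\<close> at \<open>(1, 2)\<close> leave only one
  family.\<close>

lemma the_D_family:
  assumes n: "2 \<le> n"
  shows "(THE F. F \<in> pairs n \<rightarrow>\<^sub>E carrier R \<and> (\<forall>i\<in>{1..<n}. F (i, i + 1) = d i) \<and>
      (\<forall>w\<in>carrier (sym_group n). \<forall>(i, j)\<in>pairs n. w i < w j \<longrightarrow>
        perm w \<otimes> F (i, j) \<otimes> inv (perm w) = F (w i, w j))) =
    restrict (\<lambda>(i, j). dd i j) (pairs n)"
proof (rule the_equality, fold conjugate_def, intro conjI)
  show "restrict (\<lambda>(i, j). dd i j) (pairs n) \<in> pairs n \<rightarrow>\<^sub>E carrier R"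
    by (auto simp: pairs_def intro!: dd_closed)
  show "\<forall>i\<in>{1..<n}. restrict (\<lambda>(i, j). dd i j) (pairs n) (i, i + 1) = d i"
    using dd_adjacent by (simp add: pairs_def)
  show "\<forall>w\<in>carrier (sym_group n). \<forall>(i, j)\<in>pairs n. w i < w j \<longrightarrow>
      conjugate w (restrict (\<lambda>(i, j). dd i j) (pairs n) (i, j)) =
        restrict (\<lambda>(i, j). dd i j) (pairs n) (w i, w j)"
  proof (clarify)
    fix w i j
    assume w: "w \<in> carrier (sym_group n)" and ij: "(i, j) \<in> pairs n" "w i < w j"
    then have "w permutes {1..n}"
      by (simp add: sym_group_carrier)
    moreover from this have "(w i, w j) \<in> pairs n"
      using ij permutes_in_image[of w "{1..n}" i] permutes_in_image[of w "{1..n}" j]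
      by (simp add: pairs_def)
    ultimately show "conjugate w (restrict (\<lambda>(i, j). dd i j) (pairs n) (i, j)) =
        restrict (\<lambda>(i, j). dd i j) (pairs n) (w i, w j)"
      using ij conjugate_dd[of w i j] by (simp add: pairs_def)
  qed
next
  fix F
  assume F: "F \<in> pairs n \<rightarrow>\<^sub>E carrier R \<and> (\<forall>i\<in>{1..<n}. F (i, i + 1) = d i) \<and>
      (\<forall>w\<in>carrier (sym_group n). \<forall>(i, j)\<in>pairs n. w i < w j \<longrightarrow> conjugate w (F (i, j)) = F (w i, w j))"
  show "F = restrict (\<lambda>(i, j). dd i j) (pairs n)"
  proof (rule extensionalityI[of _ "pairs n"])
    fix p
    assume p: "p \<in> pairs n"
    then obtain i j where ij: "p = (i, j)" "i \<in> {1..n}" "j \<in> {1..n}" "i < j"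
      by (auto simp: pairs_def)
    obtain w where w: "w permutes {1..n}" "w 1 = i" "w 2 = j"
      using pair_image[of i j] ij by auto
    have "F (1, 2) = d 1"
      using F n by (auto dest: bspec[of _ _ 1] simp: numeral_2_eq_2)
    moreover have "(1, 2) \<in> pairs n"
      using n by (simp add: pairs_def)
    moreover have "conjugate w (F (i, j)) = F (w i, w j)"
      if "w permutes {1..n}" "(i, j) \<in> pairs n" "w i < w j" for w i j
      using F that unfolding sym_group_carrier[symmetric] by blast
    ultimately have "F p = conjugate w (d 1)"
      using w ij(1,4) by metis
    then show "F p = restrict (\<lambda>(i, j). dd i j) (pairs n) p"
      using dd_eq_conjugate[OF w(1) n] p w(2,3) ij(1) by simp
  qed (use F in \<open>auto simp: PiE_def\<close>)
qed

end

section \<open>The presentation\<close>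

definition H_proj :: "nat \<Rightarrow> hgen free_alg \<Rightarrow> hgen free_alg set" where
  "H_proj n p = (Idl\<^bsub>free_ring (H_gens n)\<^esub> (H_relators n)) +>\<^bsub>free_ring (H_gens n)\<^esub> p"

lemma H_proj_hom: "ring_hom_ring (free_ring (H_gens n)) (H_alg n) (H_proj n)"
  using presented_proj_hom[OF H_relators_closed] unfolding H_alg_def H_proj_def .

lemma H_proj_gen: "H_proj n (gen (S i)) = H_s n i" "H_proj n (gen (D i)) = H_D n i"
  by (simp_all add: H_proj_def H_s_def H_D_def presented_gen_def)

lemma H_proj_eq_iff:
  assumes "p \<in> carrier (free_ring (H_gens n))" "q \<in> carrier (free_ring (H_gens n))"
  shows "H_proj n p = H_proj n q \<longleftrightarrow> p - q \<in> Idl\<^bsub>free_ring (H_gens n)\<^esub> (H_relators n)"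
  unfolding H_proj_def by (rule presented_proj_eq_iff[OF H_relators_closed assms])

lemma H_relators_mems:
  "i \<in> {1..<n} \<Longrightarrow> gen (S i) * gen (S i) - 1 \<in> H_relators n"
  "i \<in> {1..<n} \<Longrightarrow> (gen (S i) * gen (D i) + gen (D i) * gen (S i)) - (gen (S i) - 1) \<in> H_relators n"
  "i \<in> {1..<n} \<Longrightarrow> gen (D i) * gen (D i) - gen (D i) \<in> H_relators n"
  unfolding H_relators_def Let_def power2_eq_square by (rule UnI1, rule UnI1, blast)+

lemma H_relators_mems_commute:
  assumes "i \<in> {1..<n}" "j \<in> {1..<n}" "\<bar>int i - int j\<bar> > 1"
  shows "gen (S j) * gen (S i) - gen (S i) * gen (S j) \<in> H_relators n"
    "gen (D j) * gen (S i) - gen (S i) * gen (D j) \<in> H_relators n"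
    "gen (D j) * gen (D i) - gen (D i) * gen (D j) \<in> H_relators n"
  unfolding H_relators_def Let_def
  by (rule UnI1, rule UnI2, rule UN_I[of "(i, j)"], use assms in simp, simp)+

lemma H_relators_mems_braid:
  assumes "i \<in> {1..<n}" "j \<in> {1..<n}" "\<bar>int i - int j\<bar> = 1"
  shows "gen (S j) * gen (S i) * gen (S j) - gen (S i) * gen (S j) * gen (S i) \<in> H_relators n"
    "gen (D i) * gen (S j) * gen (S i) - gen (S j) * gen (S i) * gen (D j) \<in> H_relators n"
    "gen (D j) * gen (S i) * gen (D j) - (gen (S i) * gen (D j) * gen (D i)
      + gen (D i) * gen (D j) * gen (S i) + gen (S i) * gen (D j) * gen (S i)) \<in> H_relators n"
  unfolding H_relators_def Let_def
  by (rule UnI2, rule UN_I[of "(i, j)"], use assms in simp, simp)+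

lemma hecke_ring_H_alg: "hecke_ring (H_alg n) (H_s n) (H_D n) n"
proof -
  let ?F = "free_ring (H_gens n)"
  let ?I = "Idl\<^bsub>?F\<^esub> (H_relators n)"
  let ?s = "\<lambda>i. gen (S i) :: hgen free_alg"
  let ?d = "\<lambda>i. gen (D i) :: hgen free_alg"
  interpret \<pi>: ring_hom_ring ?F "H_alg n" "H_proj n"
    by (rule H_proj_hom)
  note I = ideal_free_ringD[OF \<pi>.R.genideal_ideal[OF H_relators_closed]]
  have in_I: "r \<in> ?I" if "r \<in> H_relators n" for r
    using \<pi>.R.genideal_self[OF H_relators_closed] that by blast
  have gens: "?s i \<in> carrier ?F" "?d i \<in> carrier ?F" if "i \<in> {1..<n}" for i
    using that by (simp_all add: free_ring_closed H_gens_def)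
  note mult = \<pi>.hom_mult[unfolded free_ring_simps]
  note add = \<pi>.hom_add[unfolded free_ring_simps]
  have one: "H_proj n 1 = \<one>\<^bsub>H_alg n\<^esub>"
    using \<pi>.hom_one by (simp add: free_ring_simps)
  have eq: "H_proj n p = H_proj n q"
    if "p - q \<in> H_relators n" "p \<in> carrier ?F" "q \<in> carrier ?F" for p q
    using H_proj_eq_iff[OF that(2,3)] in_I[OF that(1)] by simp
  show ?thesis
  proof (unfold_locales, fold H_proj_gen)
    fix i
    assume i: "i \<in> {1..<n}"
    note closed = gens[OF i]
    show "H_proj n (?s i) \<in> carrier (H_alg n)" "H_proj n (?d i) \<in> carrier (H_alg n)"
      using closed by simp_all
    show "H_proj n (?s i) \<otimes>\<^bsub>H_alg n\<^esub> H_proj n (?s i) = \<one>\<^bsub>H_alg n\<^esub>"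
      using eq[OF H_relators_mems(1)[OF i]] closed by (simp add: free_ring_closed mult one)
    show "H_proj n (?d i) \<otimes>\<^bsub>H_alg n\<^esub> H_proj n (?d i) = H_proj n (?d i)"
      using eq[OF H_relators_mems(3)[OF i]] closed by (simp add: free_ring_closed mult)
    {
      fix j
      assume j: "j \<in> {1..<n}" and "i + 1 < j"
      \<comment> \<open>The reversed order \<open>(j, i)\<close> selects the relator in which
        \<open>s j\<close> commutes with \<open>d i\<close>.\<close>
      then have far: "\<bar>int i - int j\<bar> > 1" "\<bar>int j - int i\<bar> > 1"
        by linarith+
      show "H_proj n (?s i) \<otimes>\<^bsub>H_alg n\<^esub> H_proj n (?s j) = H_proj n (?s j) \<otimes>\<^bsub>H_alg n\<^esub> H_proj n (?s i)"
        using eq[OF H_relators_mems_commute(1)[OF j i far(2)]] closed gens[OF j]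
        by (simp add: free_ring_closed mult)
      show "H_proj n (?s j) \<otimes>\<^bsub>H_alg n\<^esub> H_proj n (?d i) = H_proj n (?d i) \<otimes>\<^bsub>H_alg n\<^esub> H_proj n (?s j)"
        using eq[OF H_relators_mems_commute(2)[OF j i far(2)]] closed gens[OF j]
        by (simp add: free_ring_closed mult)
      show "H_proj n (?d i) \<otimes>\<^bsub>H_alg n\<^esub> H_proj n (?d j) = H_proj n (?d j) \<otimes>\<^bsub>H_alg n\<^esub> H_proj n (?d i)"
        using eq[OF H_relators_mems_commute(3)[OF j i far(2)]] closed gens[OF j]
        by (simp add: free_ring_closed mult)
    }
    {
      assume j: "Suc i \<in> {1..<n}"
      have near: "\<bar>int i - int (Suc i)\<bar> = 1" "\<bar>int (Suc i) - int i\<bar> = 1"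
        by simp_all
      show "H_proj n (?s i) \<otimes>\<^bsub>H_alg n\<^esub> (H_proj n (?s (Suc i)) \<otimes>\<^bsub>H_alg n\<^esub> H_proj n (?s i)) =
          H_proj n (?s (Suc i)) \<otimes>\<^bsub>H_alg n\<^esub> (H_proj n (?s i) \<otimes>\<^bsub>H_alg n\<^esub> H_proj n (?s (Suc i)))"
        using eq[OF H_relators_mems_braid(1)[OF j i near(2)]] closed gens[OF j]
        by (simp add: free_ring_closed mult mult.assoc)
      show "H_proj n (?d i) \<otimes>\<^bsub>H_alg n\<^esub> (H_proj n (?s (Suc i)) \<otimes>\<^bsub>H_alg n\<^esub> H_proj n (?s i)) =
          H_proj n (?s (Suc i)) \<otimes>\<^bsub>H_alg n\<^esub> (H_proj n (?s i) \<otimes>\<^bsub>H_alg n\<^esub> H_proj n (?d (Suc i)))"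
        using eq[OF H_relators_mems_braid(2)[OF i j near(1)]] closed gens[OF j]
        by (simp add: free_ring_closed mult mult.assoc)
    }
    fix j
    assume j: "j \<in> {1..<n}" and adj: "j = Suc i \<or> i = Suc j"
    let ?x = "?s i * ?d j * ?s i"
    define r\<^sub>1 r\<^sub>2 r\<^sub>3 :: "hgen free_alg" where
      "r\<^sub>1 = ?s i * ?s i - 1" and
      "r\<^sub>2 = (?s i * ?d i + ?d i * ?s i) - (?s i - 1)" and
      "r\<^sub>3 = ?d j * ?s i * ?d j - (?s i * ?d j * ?d i + ?d i * ?d j * ?s i + ?s i * ?d j * ?s i)"
    have r: "r\<^sub>1 \<in> ?I" "r\<^sub>2 \<in> ?I" "r\<^sub>3 \<in> ?I"
      unfolding r\<^sub>1_def r\<^sub>2_def r\<^sub>3_def using adj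
      by (intro in_I H_relators_mems(1,2)[OF i] H_relators_mems_braid(3)[OF i j]; auto)+
    \<comment> \<open>An explicit certificate: \<open>r\<^sub>3\<close> is multiplied by
      \<open>s i\<close> on the right, the multiples of \<open>r\<^sub>1\<close> remove squares of
      \<open>s i\<close>, and the multiple of \<open>r\<^sub>2\<close> trades
      \<open>d i * s i\<close> for \<open>s i * d i\<close>.\<close>
    have "(?d i * ?d j + ?x) - (?x * ?d i + ?d j * ?x) =
        - (r\<^sub>3 * ?s i) - ?d i * ?d j * r\<^sub>1 - ?s i * ?d j * r\<^sub>1 - ?s i * ?d j * r\<^sub>2"
      unfolding r\<^sub>1_def r\<^sub>2_def r\<^sub>3_def by (simp add: algebra_simps)
    moreover have "\<dots> \<in> ?I"
      using r closed gens[OF j] by (intro I(4-7) free_ring_closed(7))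
    ultimately have "H_proj n (?d i * ?d j + ?x) = H_proj n (?x * ?d i + ?d j * ?x)"
      using closed gens[OF j] by (simp add: H_proj_eq_iff free_ring_closed)
    then show "H_proj n (?d i) \<otimes>\<^bsub>H_alg n\<^esub> H_proj n (?d j) \<oplus>\<^bsub>H_alg n\<^esub>
          H_proj n (?s i) \<otimes>\<^bsub>H_alg n\<^esub> H_proj n (?d j) \<otimes>\<^bsub>H_alg n\<^esub> H_proj n (?s i) =
        H_proj n (?s i) \<otimes>\<^bsub>H_alg n\<^esub> H_proj n (?d j) \<otimes>\<^bsub>H_alg n\<^esub> H_proj n (?s i) \<otimes>\<^bsub>H_alg n\<^esub> H_proj n (?d i)
          \<oplus>\<^bsub>H_alg n\<^esub> H_proj n (?d j) \<otimes>\<^bsub>H_alg n\<^esub>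
            (H_proj n (?s i) \<otimes>\<^bsub>H_alg n\<^esub> H_proj n (?d j) \<otimes>\<^bsub>H_alg n\<^esub> H_proj n (?s i))"
      using closed gens[OF j] by (simp add: free_ring_closed mult add)
  qed
qed

interpretation H: hecke_ring "H_alg n" "H_s n" "H_D n" n for n
  by (rule hecke_ring_H_alg)

text \<open>The definite descriptions in \<open>D_family\<close> and \<open>perm_img\<close> are
  those of the locale at \<open>H_alg n\<close>, so unfolding identifies them.\<close>

lemma D_family_eq: "2 \<le> n \<Longrightarrow> D_family n = restrict (\<lambda>(i, j). H.dd n i j) (pairs n)"
  unfolding D_family_def using H.the_D_family[of n]
  unfolding H.perm_def perm_img_def[symmetric] .

lemma H_proj_D_word:
  assumes "1 \<le> i" "i + k < n"
  shows "H_proj n (D_word i k) = H.dd n i (Suc (i + k))"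
  using assms(2)
proof (induction k)
  case 0
  then show ?case
    using H.dd_adjacent[of i n] assms(1) by (simp add: H_proj_gen)
next
  case (Suc k)
  interpret \<pi>: ring_hom_ring "free_ring (H_gens n)" "H_alg n" "H_proj n"
    by (rule H_proj_hom)
  have "gen (S (i + Suc k)) \<in> carrier (free_ring (H_gens n))"
    using Suc.prems by (simp add: free_ring_closed H_gens_def)
  moreover have "D_word i k \<in> carrier (free_ring (H_gens n))"
    using Suc.prems assms(1) by (intro D_word_closed) simp_all
  ultimately show ?case
    using Suc H.dd_step[of i "i + Suc k" n] assms(1)
    by (simp add: \<pi>.hom_mult[unfolded free_ring_simps] free_ring_closed H_proj_gen)
qed

lemma H_proj_D_lift:
  assumes "p \<in> pairs n"
  shows "H_proj n (D_lift p) = H.dd n (fst p) (snd p)"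
  using assms H_proj_D_word[of "fst p" "snd p - Suc (fst p)" n]
  by (auto simp: D_lift_def pairs_def)

theorem proposition1p7:
  fixes n :: nat
  assumes "n \<ge> 2"
  shows "\<exists>\<phi> \<in> ring_iso (presented_ring (pairs n) (D_relators n)) (D_alg n).
           \<forall>p \<in> pairs n. \<phi> (presented_gen (pairs n) (D_relators n) p) = D_family n p"
proof -
  let ?F = "free_ring (pairs n)"
  \<comment> \<open>Factoring through the free algebra on \<open>H_gens n\<close> reduces the kernel
    to a question about lifted words, answered by \<open>subst_D_lift_inj\<close>.\<close>
  define h where "h p = H_proj n (subst_alg D_lift p)" for p
  interpret \<pi>: ring_hom_ring "free_ring (H_gens n)" "H_alg n" "H_proj n"
    by (rule H_proj_hom)
  have lift_hom: "subst_alg D_lift \<in> ring_hom ?F (free_ring (H_gens n))"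
    by (rule subst_alg_ring_hom) (rule D_lift_closed)
  interpret hom: ring_hom_ring ?F "H_alg n" h
    using ring_hom_ringI2[OF ring_free_ring ring_H_alg ring_hom_trans[OF lift_hom \<pi>.homh]]
    by (simp add: comp_def h_def[abs_def])
  have h_gen: "h (gen (i, j)) = H.dd n i j" if "(i, j) \<in> pairs n" for i j
    using H_proj_D_lift[OF that] by (simp add: h_def)
  have h_mult: "h (p * q) = h p \<otimes>\<^bsub>H_alg n\<^esub> h q" if "p \<in> carrier ?F" "q \<in> carrier ?F" for p q
    using hom.hom_mult[OF that] by (simp add: free_ring_simps)
  have h_add: "h (p + q) = h p \<oplus>\<^bsub>H_alg n\<^esub> h q" if "p \<in> carrier ?F" "q \<in> carrier ?F" for p q
    using hom.hom_add[OF that] by (simp add: free_ring_simps)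
  have kernel: "p - q \<in> a_kernel ?F (H_alg n) h"
    if "p \<in> carrier ?F" "q \<in> carrier ?F" "h p = h q" for p q
  proof -
    have "h (p - q) = h p \<oplus>\<^bsub>H_alg n\<^esub> \<ominus>\<^bsub>H_alg n\<^esub> h q"
      using h_add[of p "- q"] hom.hom_a_inv[of q] that
      by (simp add: free_ring_closed free_ring_a_inv)
    then have "h (p - q) = \<zero>\<^bsub>H_alg n\<^esub>"
      using that hom.hom_closed[of q] H.r_neg[of "h q" n] by simp
    then show ?thesis
      using free_ring_closed(6)[OF that(1,2)] unfolding a_kernel_def' by blast
  qed
  have "D_relators n \<subseteq> a_kernel ?F (H_alg n) h"
  proof
    fix r
    assume "r \<in> D_relators n"
    then consider
        (idem) i j where "(i, j) \<in> pairs n" "r = gen (i, j) * gen (i, j) - gen (i, j)"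
      | (comm) i j k l where "(i, j) \<in> pairs n" "(k, l) \<in> pairs n" "{i, j} \<inter> {k, l} = {}"
          "r = gen (i, j) * gen (k, l) - gen (k, l) * gen (i, j)"
      | (left) i j k where "1 \<le> i" "i < j" "j < k" "k \<le> n"
          "r = gen (i, j) * gen (j, k)
            - (gen (i, k) * gen (i, j) + gen (j, k) * gen (i, k) - gen (i, k))"
      | (right) i j k where "1 \<le> i" "i < j" "j < k" "k \<le> n"
          "r = gen (j, k) * gen (i, j)
            - (gen (i, j) * gen (i, k) + gen (i, k) * gen (j, k) - gen (i, k))"
      unfolding D_relators_def Let_def power2_eq_square by blast
    then show "r \<in> a_kernel ?F (H_alg n) h"
    proof cases
      case idem
      have "H.dd n i j \<otimes>\<^bsub>H_alg n\<^esub> H.dd n i j = H.dd n i j"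
        using idem(1) by (intro H.dd_idem) (auto simp: pairs_def)
      then show ?thesis
        unfolding idem(2) using idem(1) by (intro kernel) (simp_all add: free_ring_closed h_mult h_gen)
    next
      case comm
      have "H.dd n i j \<otimes>\<^bsub>H_alg n\<^esub> H.dd n k l = H.dd n k l \<otimes>\<^bsub>H_alg n\<^esub> H.dd n i j"
        using comm(1-3) by (intro H.dd_commute) (auto simp: pairs_def)
      then show ?thesis
        unfolding comm(4) using comm(1,2)
        by (intro kernel) (simp_all add: free_ring_closed h_mult h_gen)
    next
      case left
      then have p: "(i, j) \<in> pairs n" "(j, k) \<in> pairs n" "(i, k) \<in> pairs n"
        by (auto simp: pairs_def)
      \<comment> \<open>The summand \<open>gen (i, k)\<close> is moved across to match
        \<open>dd_triangle\<close>, which is stated without subtraction.\<close>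
      have "(gen (i, j) * gen (j, k) + gen (i, k))
          - (gen (i, k) * gen (i, j) + gen (j, k) * gen (i, k)) \<in> a_kernel ?F (H_alg n) h"
        using H.dd_triangle(1)[OF left(1-4)] p
        by (intro kernel) (simp_all add: free_ring_closed h_mult h_add h_gen)
      then show ?thesis
        unfolding left(5) by (simp add: algebra_simps)
    next
      case right
      then have p: "(i, j) \<in> pairs n" "(j, k) \<in> pairs n" "(i, k) \<in> pairs n"
        by (auto simp: pairs_def)
      have "(gen (j, k) * gen (i, j) + gen (i, k))
          - (gen (i, k) * gen (j, k) + gen (i, j) * gen (i, k)) \<in> a_kernel ?F (H_alg n) h"
        using H.dd_triangle(2)[OF right(1-4)] p
        by (intro kernel) (simp_all add: free_ring_closed h_mult h_add h_gen)
      then show ?thesis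
        unfolding right(5) by (simp add: algebra_simps)
    qed
  qed
  then have sub: "Idl\<^bsub>?F\<^esub> (D_relators n) \<subseteq> a_kernel ?F (H_alg n) h"
    by (rule Idl_free_ring_subset[OF _ hom.kernel_is_ideal])
  \<comment> \<open>One direction is the injectivity obtained from the action on \<open>1\<close>;
    the other is the validity of the relations for the \<open>dd\<close> elements.\<close>
  have ker: "h p = \<zero>\<^bsub>H_alg n\<^esub> \<longleftrightarrow> p \<in> Idl\<^bsub>?F\<^esub> (D_relators n)" if p: "p \<in> carrier ?F" for p
  proof
    assume "h p = \<zero>\<^bsub>H_alg n\<^esub>"
    then have "H_proj n (subst_alg D_lift p) = H_proj n 0"
      using \<pi>.hom_zero by (simp add: free_ring_simps h_def)
    moreover have "subst_alg D_lift p \<in> carrier (free_ring (H_gens n))"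
      by (rule subst_alg_closed[OF p D_lift_closed])
    ultimately have "subst_alg D_lift p \<in> Idl\<^bsub>free_ring (H_gens n)\<^esub> (H_relators n)"
      by (simp add: H_proj_eq_iff free_ring_closed)
    then show "p \<in> Idl\<^bsub>?F\<^esub> (D_relators n)"
      by (rule subst_D_lift_inj[OF p])
  next
    assume "p \<in> Idl\<^bsub>?F\<^esub> (D_relators n)"
    then show "h p = \<zero>\<^bsub>H_alg n\<^esub>"
      using sub unfolding a_kernel_def' by blast
  qed
  have family: "h (gen p) = D_family n p" if "p \<in> pairs n" for p
    using h_gen[of "fst p" "snd p"] that by (simp add: D_family_eq[OF assms] case_prod_beta)
  then have "h ` gen ` pairs n = D_family n ` pairs n"
    by (force simp: image_iff)
  then show ?thesis
    using presented_ring_iso[OF D_relators_closed hom.ring_hom_ring_axioms ker] family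
    unfolding D_alg_def by simp
qed

end
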